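(* Let $(\xi_n)$ satisfy the noise assumption and let $f$ satisfy Assumption C (see context). Put $L_0:=-f'(K)$ and $\alpha_0:=\dfrac{-f'(K)-1}{-f'(K)+1}$. Assume that for some $\alpha\in(0,\alpha_0)$, $\ell\in\bigl(\alpha_0-\alpha,\min\{\alpha,1-\alpha\}\bigr)$ and $\lambda_1>0$, either $$\alpha+\ell<\frac{L_0}{L_0+1}\quad\text{and}\quad \mathbb E\ln\bigl[(1-\alpha-\ell\xi)L_0-\alpha-\ell\xi\bigr]=-\lambda_1<0,$$ or $$\mathbb E\max\bigl\{\ln[(1-\alpha-\ell\xi)L_0],\ \ln[\alpha+\ell\xi]\bigr\}=-\lambda_1<0$$ holds, where $\xi$ has the common distribution of the $\xi_n$. Then for any $x_0>0$ the solution of $$x_{n+1}=(1-\alpha-\ell\xi_{n+1})f(x_n)+(\alpha+\ell\xi_{n+1})x_n,\qquad n=0,1,2,\dots,$$ satisfies $\lim_{n\to\infty}x_n=K$ almost surely.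
   Context: Noise assumption: $(\xi_n)_{n\in\mathbb N}$ is a sequence of independent identically distributed random variables on a probability space $(\Omega,\mathcal F,\mathbb P)$ with $|\xi_n|\le1$ for all $n$, and $\mathbb P\{\xi_n\in(1-\varepsilon,1]\}>0$ for each $\varepsilon>0$. Assumption C on $f$: $f:[0,\infty)\to[0,\infty)$ is continuous, $f(0)=0$, $f$ has exactly one positive equilibrium (fixed point) $K>0$, which is locally unstable (not Lyapunov stable) for $x_{n+1}=f(x_n)$; $f(x)>x$ for $x\in(0,K)$ and $0<f(x)<x$ for $x\in(K,\infty)$. Moreover $f$ is unimodal and three times differentiable, with a unique critical point $c\in(0,K)$, which is a maximum, $f'(0)>1$, $f''(x)<0$ for all $x\in(0,c)$, and the Schwarzian derivative $$(Sf)(x)=\frac{f'''(x)}{f'(x)}-\frac32\left(\frac{f''(x)}{f'(x)}\right)^2$$ is negative on $(0,\infty)\setminus\{c\}$. *)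

theory Defs
  imports "HOL-Probability.Probability"
begin

text \<open>
  Functions on the half-line are rendered as total functions on the reals of which only the values
  on \<open>{0..}\<close> matter. Derivatives are therefore taken within \<open>{0..}\<close>: one-sided at 0, and the usual
  two-sided derivative at every positive point.
\<close>

definition half_deriv :: "(real \<Rightarrow> real) \<Rightarrow> real \<Rightarrow> real" where
  "half_deriv f x = vector_derivative f (at x within {0..})"

lemma half_deriv_eq:
  assumes "(f has_real_derivative d) (at x within {0..})" and "x \<ge> 0"
  shows "half_deriv f x = d"
proof -
  have "at_right x \<le> at x within {0..}"
    using assms(2) by (intro at_le) auto
  hence "at x within {0..} \<noteq> bot"
    using trivial_limit_at_right_real[of x] by (metis bot_unique)
  thus ?thesis
    unfolding half_deriv_def using assms(1)
    by (intro vector_derivative_within) (auto simp: has_real_derivative_iff_has_vector_derivative)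
qed

lemma half_deriv_eq_deriv:
  assumes "f differentiable (at x)" and "x > 0"
  shows "half_deriv f x = deriv f x"
proof (rule half_deriv_eq)
  have "(f has_real_derivative deriv f x) (at x)"
    using assms(1) by (auto simp: real_differentiable_def DERIV_imp_deriv)
  thus "(f has_real_derivative deriv f x) (at x within {0..})"
    by (rule has_field_derivative_at_within)
qed (use assms in auto)

definition three_times_differentiable :: "(real \<Rightarrow> real) \<Rightarrow> bool" where
  "three_times_differentiable f \<longleftrightarrow> (\<forall>k<3. (half_deriv ^^ k) f differentiable_on {0..})"

definition schwarzian :: "(real \<Rightarrow> real) \<Rightarrow> real \<Rightarrow> real" where
  "schwarzian f x =
     (half_deriv ^^ 3) f x / half_deriv f x - 3 / 2 * ((half_deriv ^^ 2) f x / half_deriv f x)\<^sup>2"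

definition lyapunov_stable :: "(real \<Rightarrow> real) \<Rightarrow> real \<Rightarrow> bool" where
  "lyapunov_stable f K \<longleftrightarrow>
     (\<forall>\<epsilon>>0. \<exists>\<delta>>0. \<forall>x\<ge>0. \<bar>x - K\<bar> < \<delta> \<longrightarrow> (\<forall>n. \<bar>(f ^^ n) x - K\<bar> < \<epsilon>))"

definition unimodal_with_peak :: "(real \<Rightarrow> real) \<Rightarrow> real \<Rightarrow> bool" where
  "unimodal_with_peak f c \<longleftrightarrow> strict_mono_on {0..c} f \<and> strict_antimono_on {c..} f"

definition assumption_C :: "(real \<Rightarrow> real) \<Rightarrow> real \<Rightarrow> bool" where
  "assumption_C f K \<longleftrightarrow>
     f \<in> {0..} \<rightarrow> {0..} \<and> continuous_on {0..} f \<and> f 0 = 0 \<and>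
     K > 0 \<and> (\<forall>x>0. f x = x \<longleftrightarrow> x = K) \<and> \<not> lyapunov_stable f K \<and>
     (\<forall>x\<in>{0<..<K}. f x > x) \<and> (\<forall>x\<in>{K<..}. 0 < f x \<and> f x < x) \<and>
     three_times_differentiable f \<and> half_deriv f 0 > 1 \<and>
     (\<exists>c\<in>{0<..<K}.
        unimodal_with_peak f c \<and>
        (\<forall>x>0. half_deriv f x = 0 \<longleftrightarrow> x = c) \<and> (\<forall>x\<ge>0. f x \<le> f c) \<and>
        (\<forall>x\<in>{0<..<c}. (half_deriv ^^ 2) f x < 0) \<and>
        (\<forall>x\<in>{0<..} - {c}. schwarzian f x < 0))"

text \<open>The noise sequence is indexed from 1, since the recursion only uses the terms \<open>\<xi> (n + 1)\<close>.\<close>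

definition noise_assumption :: "'a measure \<Rightarrow> (nat \<Rightarrow> 'a \<Rightarrow> real) \<Rightarrow> bool" where
  "noise_assumption M \<xi> \<longleftrightarrow>
     prob_space M \<and>
     prob_space.indep_vars M (\<lambda>_. borel) \<xi> {1..} \<and>
     (\<forall>m\<ge>1. \<forall>n\<ge>1. distr M borel (\<xi> m) = distr M borel (\<xi> n)) \<and>
     (\<forall>n\<ge>1. \<forall>\<omega>\<in>space M. \<bar>\<xi> n \<omega>\<bar> \<le> 1) \<and>
     (\<forall>n\<ge>1. \<forall>\<epsilon>>0. measure M {\<omega> \<in> space M. \<xi> n \<omega> \<in> {1 - \<epsilon><..1}} > 0)"

definition controlled_solution ::
  "'a measure \<Rightarrow> (real \<Rightarrow> real) \<Rightarrow> real \<Rightarrow> real \<Rightarrow> (nat \<Rightarrow> 'a \<Rightarrow> real) \<Rightarrow> real \<Rightarrow> (nat \<Rightarrow> 'a \<Rightarrow> real) \<Rightarrow> bool"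
where
  "controlled_solution M f \<alpha> l \<xi> x0 x \<longleftrightarrow>
     (\<forall>\<omega>\<in>space M. x 0 \<omega> = x0 \<and>
        (\<forall>n. x (Suc n) \<omega> =
               (1 - \<alpha> - l * \<xi> (Suc n) \<omega>) * f (x n \<omega>) + (\<alpha> + l * \<xi> (Suc n) \<omega>) * x n \<omega>))"

end

theory Submission
  imports Defs
begin

text \<open>
  A step of the recursion applies the averaged map \<open>x \<mapsto> (1 - a) * f x + a * x\<close> with the random
  weight \<open>a = \<alpha> + l * \<xi>\<close>. Its slope at \<open>K\<close> is \<open>a - (1 - a) * L0\<close>, and either alternative of the
  moment condition says that this slope, or an upper bound \<open>Y a\<close> for its modulus, is contractive on
  average: \<open>E (ln (Y a)) < 0\<close>. So \<open>K\<close> is attracting for the random dynamics, but only locally and only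
  with some probability. Convergence from everywhere and almost surely comes from three ingredients.

  Global attraction for the extreme control \<open>b = \<alpha> + l\<close>. Since \<open>b > \<alpha>0\<close>, the slope at \<open>K\<close> is
  above \<open>-1\<close>. If the averaged map with weight \<open>b\<close> did not attract a trapping interval to \<open>K\<close>, there
  would be points \<open>r < K < y\<close> that it maps across \<open>K\<close> to outside the open interval between them. The
  closest such pair is a 2-cycle on which the map is decreasing, and Singer's argument with
  the negative Schwarzian derivative shows that such a cycle cannot surround an attracting fixed
  point (\<open>averaged_map_no_crossing_pair\<close>). The Schwarzian derivative of the averaged map need not be
  negative everywhere, but it is negative wherever that map decreases. By compactness the attraction is
  uniform, so a fixed number \<open>N\<close> of steps with noise close to 1 brings every point of the trapping
  interval near \<open>K\<close> (\<open>averaged_map_uniform_entry\<close>).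

  No escape with positive probability. The exponents \<open>ln (Y a)\<close> form a bounded random walk with negative
  drift, so with probability close to 1 it stays below a level \<open>R\<close> forever. On that event a solution
  that starts within a distance of order \<open>exp (- R)\<close> of \<open>K\<close> never leaves the neighbourhood in which the
  linearisation is valid, and it converges.

  A zero-one law. The event \<open>G n\<close>, that after time \<open>n\<close> a block of \<open>N\<close> noise values near 1 is followed by a
  walk staying below \<open>R\<close>, involves only the noise after time \<open>n\<close> and has a probability bounded
  below independently of \<open>n\<close>. Hence almost surely some \<open>G n\<close> occurs
  (\<open>AE_block_then_bounded_walk\<close>). As the trapping interval contains the whole solution, any one
  of the \<open>G n\<close> suffices, whatever the state at time \<open>n\<close> is.
\<close>

section \<open>Negative Schwarzian derivative\<close>

text \<open>
  The second-order necessary condition. In its applications \<open>d\<close> is a third derivative that may be discontinuous, so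
  \<open>\<phi>'\<close> is differentiated at \<open>z\<close> alone.
\<close>
lemma interior_min_derivs:
  fixes \<phi> \<phi>' :: "real \<Rightarrow> real"
  assumes z: "s < z" "z < t"
    and min: "\<And>x. s < x \<Longrightarrow> x < t \<Longrightarrow> \<phi> z \<le> \<phi> x"
    and d1: "\<And>x. s < x \<Longrightarrow> x < t \<Longrightarrow> (\<phi> has_real_derivative \<phi>' x) (at x)"
    and d2: "(\<phi>' has_real_derivative d) (at z)"
  shows "\<phi>' z = 0" "d \<ge> 0"
proof -
  define e where "e = Min {z - s, t - z}"
  have e: "e > 0" "e \<le> z - s" "e \<le> t - z" using z by (auto simp: e_def)
  show crit: "\<phi>' z = 0"
  proof (rule DERIV_local_min[OF d1 e(1)])
    show "\<forall>y. \<bar>z - y\<bar> < e \<longrightarrow> \<phi> z \<le> \<phi> y"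
      using e by (auto intro!: min)
  qed (use z in auto)
  show "d \<ge> 0"
  proof (rule ccontr)
    assume "\<not> d \<ge> 0"
    then obtain k where k: "k > 0" "\<And>h. h > 0 \<Longrightarrow> h < k \<Longrightarrow> \<phi>' (z + h) < \<phi>' z"
      using DERIV_neg_dec_right[OF d2] by auto
    define w where "w = z + Min {k, e} / 2"
    have w: "z < w" "w < z + k" "w < t" using k(1) e by (auto simp: w_def min_def)
    have "\<phi> w < \<phi> z"
    proof (rule DERIV_neg_imp_decreasing_open[OF w(1)])
      fix x assume x: "z < x" "x < w"
      then have "\<phi>' x < 0" using k(2)[of "x - z"] w crit by simp
      then show "\<exists>y. DERIV \<phi> x :> y \<and> y < 0" using d1[of x] x z w by auto
    next
      show "continuous_on {z..w} \<phi>"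
        using w z by (auto intro!: continuous_at_imp_continuous_on DERIV_isCont[OF d1])
    qed
    with min[of w] w z show False by simp
  qed
qed

text \<open>
  This is the composition rule \<open>S(g \<circ> g) = (S g \<circ> g) (g')\<^sup>2 + S g\<close> at a critical point of
  \<open>(g \<circ> g)'\<close>, cleared of denominators. Here \<open>a, b, c\<close> are the first three derivatives of \<open>g\<close> at \<open>z\<close>
  and \<open>p, q, r\<close> those at \<open>g z\<close>; \<open>crit\<close> says that \<open>(g \<circ> g)''\<close> vanishes at \<open>z\<close>, and the conclusion
  is that \<open>(g \<circ> g)'''\<close> is negative there.
\<close>
lemma schwarzian_chain_negative:
  fixes a b c p q r :: real
  assumes "a < 0" "p < 0" "2 * c * a < 3 * b\<^sup>2" "2 * r * p < 3 * q\<^sup>2"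
    and crit: "q * a\<^sup>2 + p * b = 0"
  shows "r * a ^ 3 + 3 * q * a * b + p * c < 0"
proof -
  have "2 * (p * a) * (r * a ^ 3 + 3 * q * a * b + p * c)
      = a ^ 4 * (2 * r * p) + 6 * q * a\<^sup>2 * (p * b) + p\<^sup>2 * (2 * c * a)"
    by (simp add: power2_eq_square power3_eq_cube power4_eq_xxxx algebra_simps)
  also have "\<dots> < a ^ 4 * (3 * q\<^sup>2) + 6 * q * a\<^sup>2 * (p * b) + p\<^sup>2 * (3 * b\<^sup>2)"
    using assms by (intro add_strict_mono add_less_le_mono mult_strict_left_mono) auto
  also have "\<dots> = 3 * (q * a\<^sup>2 + p * b)\<^sup>2"
    by (simp add: power2_eq_square power4_eq_xxxx algebra_simps)
  also have "\<dots> = 0" using crit by simp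
  finally show ?thesis using assms(1,2) by (auto simp: mult_less_0_iff)
qed

text \<open>
  Singer's argument. The second iterate \<open>G\<close> is increasing on \<open>{r..y}\<close> and fixes \<open>r\<close>, \<open>K\<close> and \<open>y\<close>, so
  \<open>G'\<close> takes the value 1 on both sides of \<open>K\<close>. If \<open>K\<close> were attracting, then \<open>G' K < 1\<close> would force an
  interior minimum of \<open>G'\<close>, which a negative Schwarzian derivative excludes.
\<close>
lemma neutral_or_repelling_in_two_cycle:
  fixes g g1 g2 g3 :: "real \<Rightarrow> real"
  assumes order: "r < K" "K < y" and fixed: "g K = K" and cyc: "g r = y" "g y = r"
    and d1: "\<And>x. r \<le> x \<Longrightarrow> x \<le> y \<Longrightarrow> (g has_real_derivative g1 x) (at x)"
    and d2: "\<And>x. r \<le> x \<Longrightarrow> x \<le> y \<Longrightarrow> (g1 has_real_derivative g2 x) (at x)"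
    and d3: "\<And>x. r \<le> x \<Longrightarrow> x \<le> y \<Longrightarrow> (g2 has_real_derivative g3 x) (at x)"
    and neg: "\<And>x. r < x \<Longrightarrow> x < y \<Longrightarrow> g1 x < 0"
    and S: "\<And>x. r < x \<Longrightarrow> x < y \<Longrightarrow> 2 * g3 x * g1 x < 3 * (g2 x)\<^sup>2"
  shows "g1 K \<le> -1"
proof (rule ccontr)
  assume "\<not> g1 K \<le> -1"
  then have K1: "-1 < g1 K" "g1 K < 0" using neg order by auto
  have cont: "continuous_on {r..y} g"
    by (auto intro!: continuous_at_imp_continuous_on DERIV_isCont[OF d1])
  have dec: "g v < g u" if "r \<le> u" "u < v" "v \<le> y" for u v
  proof (rule DERIV_neg_imp_decreasing_open[OF that(2)])
    show "\<exists>l. DERIV g x :> l \<and> l < 0" if "u < x" "x < v" for x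
      using that \<open>r \<le> u\<close> \<open>v \<le> y\<close> d1[of x] neg[of x] by auto
    show "continuous_on {u..v} g" using cont by (rule continuous_on_subset) (use that in auto)
  qed
  have maps: "r < g x" "g x < y" if "r < x" "x < y" for x
    using dec[of r x] dec[of x y] that cyc order by auto
  have maps': "r \<le> g x" "g x \<le> y" if "r \<le> x" "x \<le> y" for x
    using maps[of x] cyc order that by (cases "x = r"; cases "x = y"; force)+
  define G where "G x = g (g x)" for x
  define G1 where "G1 x = g1 (g x) * g1 x" for x
  define G2 where "G2 x = g2 (g x) * (g1 x)\<^sup>2 + g1 (g x) * g2 x" for x
  define G3 where "G3 x = g3 (g x) * (g1 x) ^ 3 + 3 * g2 (g x) * g1 x * g2 x + g1 (g x) * g3 x" for x
  have D1: "(G has_real_derivative G1 x) (at x)" if "r \<le> x" "x \<le> y" for x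
    unfolding G_def G1_def
    by (rule DERIV_chain2[OF d1 d1]) (use that maps' in auto)
  have c1: "((\<lambda>x. g1 (g x)) has_real_derivative g2 (g x) * g1 x) (at x)" if "r \<le> x" "x \<le> y" for x
    by (rule DERIV_chain2[OF d2 d1]) (use that maps' in auto)
  have c2: "((\<lambda>x. g2 (g x)) has_real_derivative g3 (g x) * g1 x) (at x)" if "r \<le> x" "x \<le> y" for x
    by (rule DERIV_chain2[OF d3 d1]) (use that maps' in auto)
  have D2: "(G1 has_real_derivative G2 x) (at x)" if "r \<le> x" "x \<le> y" for x
    unfolding G1_def G2_def
    by (rule derivative_eq_intros c1[OF that] d2[OF that] refl)+ (simp add: power2_eq_square algebra_simps)
  have D3: "(G2 has_real_derivative G3 x) (at x)" if "r \<le> x" "x \<le> y" for x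
    unfolding G2_def G3_def
    by (rule derivative_eq_intros c1[OF that] c2[OF that] d2[OF that] d3[OF that] refl)+
       (simp add: power2_eq_square power3_eq_cube algebra_simps)
  have mean: "\<exists>s. u < s \<and> s < v \<and> G1 s = 1" if uv: "r \<le> u" "u < v" "v \<le> y" "G u = u" "G v = v" for u v
  proof -
    obtain z where "u < z" "z < v" "G v - G u = (v - u) * G1 z"
      using MVT2[OF uv(2), of G G1] D1 uv by (metis order_trans less_imp_le)
    then show ?thesis using uv by auto
  qed
  obtain s where s: "r < s" "s < K" "G1 s = 1"
    using mean[of r K] order fixed cyc by (auto simp: G_def)
  obtain t where t: "K < t" "t < y" "G1 t = 1"
    using mean[of K y] order fixed cyc by (auto simp: G_def)
  have GK: "G1 K < 1"
    using K1 abs_square_less_1[of "g1 K"] by (auto simp: G1_def fixed power2_eq_square)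
  have "continuous_on {s..t} G1"
    using s t by (auto intro!: continuous_at_imp_continuous_on DERIV_isCont[OF D2])
  then obtain z where z: "z \<in> {s..t}" "\<And>x. x \<in> {s..t} \<Longrightarrow> G1 z \<le> G1 x"
    using continuous_attains_inf[of "{s..t}" G1] s t by auto
  have "G1 z < 1" using z(2)[of K] s t GK by auto
  then have zst: "s < z" "z < t" using z(1) s t by (auto simp: less_le)
  have zin: "r < z" "z < y" using zst s t by auto
  have "G2 z = 0" "G3 z \<ge> 0"
    using interior_min_derivs[of s z t G1 G2 "G3 z"] zst z(2) D2 D3 s t zin by auto
  moreover have "G3 z < 0"
    using schwarzian_chain_negative[OF neg neg S S, of z "g z"] zin maps[OF zin] \<open>G2 z = 0\<close>
    unfolding G2_def G3_def by auto
  ultimately show False by simp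
qed

text \<open>
  Averaging with the identity replaces \<open>f'\<close> by a multiple of \<open>f' + b\<close>. Where the averaged map
  still decreases, the shift brings the slope closer to 0 without changing its sign, and the
  Schwarzian derivative stays negative: if \<open>f''' > 0\<close> by the signs alone, and otherwise because the
  product \<open>f''' (f' + b)\<close> is at most \<open>f''' f'\<close>.
\<close>
lemma schwarzian_negative_shift:
  fixes b f1 f2 f3 :: real
  assumes "b \<ge> 0" "f1 + b < 0" "2 * f3 * f1 < 3 * f2\<^sup>2"
  shows "2 * f3 * (f1 + b) < 3 * f2\<^sup>2"
proof (cases "f3 > 0")
  case True
  then show ?thesis using mult_pos_neg[OF True assms(2)] zero_le_power2[of f2] by linarith
next
  case False
  then have "2 * f3 * (f1 + b) \<le> 2 * f3 * f1" using assms(1)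
    by (auto intro!: mult_left_mono_neg)
  then show ?thesis using assms(3) by simp
qed

text \<open>
  Negativity of the Schwarzian derivative forbids an interior maximum of \<open>f'\<close> at a negative level,
  since there \<open>f'' = 0\<close> and \<open>f''' \<le> 0\<close>. So \<open>f'\<close> is strictly quasi-convex where it is negative, and
  the averaged map has only one interval of decrease.
\<close>
lemma deriv_below_between:
  fixes f1 f2 f3 :: "real \<Rightarrow> real"
  assumes order: "r < z" "z < y" and ends: "f1 r \<le> b" "f1 y \<le> b"
    and d2: "\<And>x. r \<le> x \<Longrightarrow> x \<le> y \<Longrightarrow> (f1 has_real_derivative f2 x) (at x)"
    and d3: "\<And>x. r \<le> x \<Longrightarrow> x \<le> y \<Longrightarrow> (f2 has_real_derivative f3 x) (at x)"
    and neg: "\<And>x. r \<le> x \<Longrightarrow> x \<le> y \<Longrightarrow> f1 x < 0"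
    and S: "\<And>x. r \<le> x \<Longrightarrow> x \<le> y \<Longrightarrow> 2 * f3 x * f1 x < 3 * (f2 x)\<^sup>2"
  shows "f1 z < b"
proof (rule ccontr)
  assume z: "\<not> f1 z < b"
  have "continuous_on {r..y} f1"
    by (auto intro!: continuous_at_imp_continuous_on DERIV_isCont[OF d2])
  then obtain m where m: "m \<in> {r..y}" "\<And>x. x \<in> {r..y} \<Longrightarrow> f1 x \<le> f1 m"
    using continuous_attains_sup[of "{r..y}" f1] order by auto
  \<comment> \<open>If the maximum is attained at an end, then it equals \<open>b\<close> and \<open>z\<close> is another maximiser.\<close>
  define w where "w = (if f1 m > b then m else z)"
  have w: "r < w" "w < y" "\<And>x. x \<in> {r..y} \<Longrightarrow> f1 x \<le> f1 w"
    using m z ends order by (fastforce simp: w_def less_le)+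
  have "- f2 w = 0" "- f3 w \<ge> 0"
    by (rule interior_min_derivs[of r w y "\<lambda>x. - f1 x" "\<lambda>x. - f2 x" "- f3 w"];
        use w in \<open>auto intro!: DERIV_minus d2 d3\<close>)+
  then have "2 * f3 w * f1 w \<ge> 3 * (f2 w)\<^sup>2"
    using neg[of w] w by (auto intro!: mult_nonpos_nonpos)
  with S[of w] w show False by simp
qed

section \<open>Attraction on a trapping interval\<close>

lemma deriv_local_bound:
  fixes f :: "real \<Rightarrow> real"
  assumes "(f has_real_derivative k) (at K)" "\<bar>k\<bar> < q"
  obtains \<eta> where "\<eta> > 0" "\<And>x. \<bar>x - K\<bar> < \<eta> \<Longrightarrow> \<bar>f x - f K\<bar> \<le> q * \<bar>x - K\<bar>"
proof -
  have "((\<lambda>x. \<bar>(f x - f K) / (x - K)\<bar>) \<longlongrightarrow> \<bar>k\<bar>) (at K)"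
    using assms(1) by (intro tendsto_rabs) (simp add: has_field_derivative_iff)
  then have "eventually (\<lambda>x. \<bar>(f x - f K) / (x - K)\<bar> < q) (at K)"
    using assms(2) by (rule order_tendstoD)
  then obtain \<eta> where \<eta>: "\<eta> > 0"
      "\<And>x. x \<noteq> K \<Longrightarrow> dist x K < \<eta> \<Longrightarrow> \<bar>(f x - f K) / (x - K)\<bar> < q"
    unfolding eventually_at by auto
  show thesis
  proof (rule that[OF \<eta>(1)])
    fix x assume x: "\<bar>x - K\<bar> < \<eta>"
    show "\<bar>f x - f K\<bar> \<le> q * \<bar>x - K\<bar>"
    proof (cases "x = K")
      case False
      then show ?thesis using \<eta>(2)[of x] x
        by (simp add: dist_real_def abs_divide divide_less_eq)
    qed simp
  qed
qed

text \<open>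
  The images \<open>X n\<close> of \<open>{u..V}\<close> under the iterates are nested compact sets, and their intersection
  \<open>L\<close> is mapped onto itself. The largest point of \<open>L\<close>, if above \<open>K\<close>, can only be the image of a
  point below \<open>K\<close>, because \<open>g\<close> moves points above \<open>K\<close> down; symmetrically for the smallest point. So
  either \<open>L = {K}\<close>, and then compactness makes the attraction uniform, or the two preimages form a
  crossing pair \<open>r < K < y\<close> with \<open>y \<le> g r\<close> and \<open>g y \<le> r\<close>.
\<close>
lemma uniform_attraction_if_no_crossing_pair:
  fixes g :: "real \<Rightarrow> real"
  assumes K: "u < K" "K < V" "g K = K"
    and cont: "continuous_on {u..V} g" and maps: "g ` {u..V} \<subseteq> {u..V}"
    and below: "\<And>x. u \<le> x \<Longrightarrow> x < K \<Longrightarrow> x < g x"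
    and above: "\<And>x. K < x \<Longrightarrow> x \<le> V \<Longrightarrow> g x < x"
    and no_pair: "\<And>r y. u \<le> r \<Longrightarrow> r < K \<Longrightarrow> K < y \<Longrightarrow> y \<le> V \<Longrightarrow> y \<le> g r \<Longrightarrow> g y \<le> r \<Longrightarrow> False"
    and d: "d > 0"
  shows "\<exists>N. \<forall>x\<in>{u..V}. \<bar>(g ^^ N) x - K\<bar> < d"
proof -
  define X where "X n = (g ^^ n) ` {u..V}" for n
  have X0: "X 0 = {u..V}" and XS: "X (Suc n) = g ` X n" for n
    by (auto simp: X_def image_image)
  have sub0: "X n \<subseteq> {u..V}" for n
    using maps by (induction n) (auto simp: X0 XS)
  have "X (Suc n) \<subseteq> X n" for n
    using maps by (induction n) (auto simp: X0 XS)
  then have mono: "X n \<subseteq> X m" if "m \<le> n" for m n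
    using lift_Suc_antimono_le[of X] that by blast
  have comp: "compact (X n)" for n
    by (induction n) (auto simp: X0 XS intro!: compact_continuous_image continuous_on_subset[OF cont sub0])
  have KX: "K \<in> X n" for n
    using K by (induction n) (auto simp: X0 XS image_iff intro: bexI[of _ K])
  define L where "L = (\<Inter>n. X n)"
  have L: "compact L" "K \<in> L" "L \<subseteq> {u..V}"
    unfolding L_def using comp KX sub0[of 0] by (auto intro!: compact_Inter)
  \<comment> \<open>A point of \<open>L\<close> has preimages in every \<open>X n\<close>; by compactness one of them lies in all \<open>X n\<close>.\<close>
  have surj: "\<exists>w\<in>L. g w = z" if z: "z \<in> L" for z
  proof -
    define F where "F n = {x \<in> X n. g x = z}" for n
    have "\<Inter>(range F) \<noteq> {}"
    proof (rule compact_nest)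
      fix n
      have "closed {x \<in> X n. g x = z}"
        using continuous_closed_preimage_constant[OF continuous_on_subset[OF cont sub0] compact_imp_closed[OF comp]]
        by simp
      moreover have "F n \<subseteq> X n" by (auto simp: F_def)
      ultimately show "compact (F n)"
        using compact_Int_closed[OF comp[of n], of "F n"] by (simp add: F_def Int_absorb1)
      have "z \<in> X (Suc n)" using z by (auto simp: L_def)
      then show "F n \<noteq> {}" by (auto simp: XS F_def)
    next
      show "F n \<subseteq> F m" if "m \<le> n" for m n
        using mono[OF that] by (auto simp: F_def)
    qed
    then show ?thesis by (auto simp: F_def L_def)
  qed
  obtain M where M: "M \<in> L" "\<And>x. x \<in> L \<Longrightarrow> x \<le> M"
    using compact_attains_sup[OF L(1)] L(2) by auto
  obtain m where m: "m \<in> L" "\<And>x. x \<in> L \<Longrightarrow> m \<le> x"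
    using compact_attains_inf[OF L(1)] L(2) by auto
  obtain r where r: "r \<in> L" "g r = M" using surj[OF M(1)] by auto
  obtain y where y: "y \<in> L" "g y = m" using surj[OF m(1)] by auto
  have r_le: "r < K" if "K < M"
    using above[of r] r M(2)[of r] K L(3) that by (cases r K rule: linorder_cases) auto
  have y_ge: "K < y" if "m < K"
    using below[of y] y m(2)[of y] K L(3) that by (cases y K rule: linorder_cases) auto
  have "M = K \<and> m = K"
  proof (rule ccontr)
    assume "\<not> (M = K \<and> m = K)"
    moreover have "m \<le> K" "K \<le> M" using M(2) m(2) L(2) by auto
    ultimately have "K < M \<or> m < K" by auto
    then have "r < K \<and> K < y" using r_le y_ge M(2) m(2) r y by fastforce
    then show False using no_pair[of r y] r y M(2)[of y] m(2)[of r] subsetD[OF L(3), of r] subsetD[OF L(3), of y] by auto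
  qed
  then have LK: "L = {K}" using M(2) m(2) L(2) by force
  have "\<exists>N. X N - ball K d = {}"
  proof (rule ccontr)
    assume "\<not> ?thesis"
    then have "(\<Inter>n. X n - ball K d) \<noteq> {}"
      using comp by (intro compact_nest) (auto intro!: compact_diff dest: subsetD[OF mono])
    then show False using LK d by (auto simp: L_def)
  qed
  then obtain N where "(g ^^ N) ` {u..V} \<subseteq> ball K d" by (auto simp: X_def)
  then have "\<forall>x\<in>{u..V}. \<bar>(g ^^ N) x - K\<bar> < d"
    by (auto simp: dist_real_def abs_minus_commute image_subset_iff)
  then show ?thesis ..
qed

text \<open>
  Take the crossing pair with the least distance \<open>y - r\<close>. It exists by compactness, because a
  locally attracting \<open>K\<close> keeps all crossing pairs away from \<open>K\<close>. Moving either end inwards must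
  destroy the crossing property, so by continuity the pair is a 2-cycle, and \<open>g\<close> moves inwards when
  its argument leaves an end of the interval inwards. In this way the turning points of \<open>g\<close> never have
  to be located.
\<close>
lemma crossing_pair_gives_two_cycle:
  fixes g :: "real \<Rightarrow> real"
  assumes K: "g K = K" "(g has_real_derivative k) (at K)" "\<bar>k\<bar> < 1"
    and cont: "continuous_on {u..V} g"
    and pair0: "u \<le> r0" "r0 < K" "K < y0" "y0 \<le> V" "y0 \<le> g r0" "g y0 \<le> r0"
  obtains r y where "u \<le> r" "r < K" "K < y" "y \<le> V" "g r = y" "g y = r"
    "\<And>x. r < x \<Longrightarrow> x < K \<Longrightarrow> g x < g r" "\<And>x. K < x \<Longrightarrow> x < y \<Longrightarrow> g y < g x"
proof -
  define q where "q = (1 + \<bar>k\<bar>) / 2"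
  have q: "0 < q" "q < 1" "\<bar>k\<bar> < q" using K(3) by (auto simp: q_def)
  obtain \<eta> where \<eta>: "\<eta> > 0" "\<And>x. \<bar>x - K\<bar> < \<eta> \<Longrightarrow> \<bar>g x - K\<bar> \<le> q * \<bar>x - K\<bar>"
    using deriv_local_bound[OF K(2) q(3)] K(1) by metis
  have strict: "q * t < t" if "t > 0" for t using q that by simp
  have away: "r \<le> K - \<eta> \<and> K + \<eta> \<le> y" if p: "r < K" "K < y" "y \<le> g r" "g y \<le> r" for r y
  proof (rule ccontr)
    assume "\<not> ?thesis"
    then consider "K - \<eta> < r" | "y < K + \<eta>" by fastforce
    then show False
    proof cases
      case 1
      then have "y - K \<le> q * (K - r)" using \<eta>(2)[of r] p by auto
      moreover from this have "y - K < K - r" using strict[of "K - r"] p by linarith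
      ultimately have "K - r \<le> q * (y - K)" using \<eta>(2)[of y] p 1 by auto
      with \<open>y - K < K - r\<close> strict[of "y - K"] p show False by linarith
    next
      case 2
      then have "K - r \<le> q * (y - K)" using \<eta>(2)[of y] p by auto
      moreover from this have "K - r < y - K" using strict[of "y - K"] p by linarith
      ultimately have "y - K \<le> q * (K - r)" using \<eta>(2)[of r] p 2 by auto
      with \<open>K - r < y - K\<close> strict[of "K - r"] p show False by linarith
    qed
  qed
  define B where "B = {u..K - \<eta>} \<times> {K + \<eta>..V}"
  define P where "P = {z \<in> B. snd z \<le> g (fst z)} \<inter> {z \<in> B. g (snd z) \<le> fst z}"
  have uKV: "u \<le> K - \<eta>" "K + \<eta> \<le> V" using away[of r0 y0] pair0 by auto
  have B: "compact B" by (auto simp: B_def intro!: compact_Times)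
  have c1: "continuous_on B (\<lambda>z. g (fst z))" "continuous_on B (\<lambda>z. g (snd z))"
    using \<eta>(1) uKV
    by (auto intro!: continuous_on_compose2[OF cont] continuous_intros simp: B_def)
  have "closed P"
    unfolding P_def using c1 compact_imp_closed[OF B]
    by (auto intro!: closed_Int continuous_on_closed_Collect_le continuous_intros)
  moreover have "P \<subseteq> B" by (auto simp: P_def)
  ultimately have "compact P" using B compact_Int_closed[of B P] by (simp add: Int_absorb1)
  moreover have "(r0, y0) \<in> P" using away[of r0 y0] pair0 by (auto simp: P_def B_def)
  moreover have "continuous_on P (\<lambda>z. snd z - fst z)" by (intro continuous_intros)
  ultimately obtain z where z: "z \<in> P" "\<And>z'. z' \<in> P \<Longrightarrow> snd z - fst z \<le> snd z' - fst z'"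
    using continuous_attains_inf[of P "\<lambda>z. snd z - fst z"] by blast
  obtain r y where ry: "z = (r, y)" by (cases z)
  have pr: "u \<le> r" "r < K" "K < y" "y \<le> V" "y \<le> g r" "g y \<le> r"
    using z(1) \<eta>(1) by (auto simp: ry P_def B_def)
  have closest: "y - r \<le> y' - r'" if "u \<le> r'" "r' < K" "K < y'" "y' \<le> V" "y' \<le> g r'" "g y' \<le> r'" for r' y'
    using z(2)[of "(r', y')"] away[of r' y'] that by (auto simp: ry P_def B_def)
  have right: "g x < y" if "r < x" "x < K" for x
    using closest[of x y] pr that by force
  have left: "r < g x" if "K < x" "x < y" for x
    using closest[of r x] pr that by force
  have lim: "continuous_on {r..K} g" "continuous_on {K..y} g"
    using pr by (auto intro: continuous_on_subset[OF cont])
  have "g r \<le> y"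
  proof (rule tendsto_upperbound)
    show "(g \<longlongrightarrow> g r) (at_right r)"
      using continuous_on_Icc_at_rightD[OF lim(1)] pr by simp
    show "eventually (\<lambda>x. g x \<le> y) (at_right r)"
      using right pr by (auto simp: eventually_at_right intro!: exI[of _ K] less_imp_le)
  qed simp
  moreover have "r \<le> g y"
  proof (rule tendsto_lowerbound)
    show "(g \<longlongrightarrow> g y) (at_left y)"
      using continuous_on_Icc_at_leftD[OF lim(2)] pr by simp
    show "eventually (\<lambda>x. r \<le> g x) (at_left y)"
      using left pr by (auto simp: eventually_at_left intro!: exI[of _ K] less_imp_le)
  qed simp
  ultimately have "g r = y" "g y = r" using pr by auto
  then show thesis using that[of r y] pr left right by auto
qed

lemma perturbed_orbit_close:
  fixes G :: "real \<Rightarrow> real \<Rightarrow> real"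
  assumes comp: "compact T" "compact X"
    and cont: "continuous_on (T \<times> X) (\<lambda>(a, x). G a x)"
    and maps: "\<And>a x. a \<in> T \<Longrightarrow> x \<in> X \<Longrightarrow> G a x \<in> X"
    and b: "b \<in> T" and d: "d > 0"
  shows "\<exists>e>0. \<forall>x a. x 0 \<in> X \<longrightarrow> (\<forall>n. a n \<in> T \<and> x (Suc n) = G (a n) (x n)) \<longrightarrow>
    (\<forall>n<N. \<bar>a n - b\<bar> < e) \<longrightarrow> \<bar>x N - (G b ^^ N) (x 0)\<bar> < d"
  using d
proof (induction N arbitrary: d)
  case 0
  then show ?case by (auto intro!: exI[of _ 1])
next
  case (Suc N)
  have "uniformly_continuous_on (T \<times> X) (\<lambda>(a, x). G a x)"
    using cont comp by (intro compact_uniformly_continuous compact_Times)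
  then obtain h where h: "h > 0" "\<And>a x a' x'. a \<in> T \<Longrightarrow> x \<in> X \<Longrightarrow> a' \<in> T \<Longrightarrow> x' \<in> X \<Longrightarrow>
      dist (a', x') (a, x) < h \<Longrightarrow> dist (G a' x') (G a x) < d"
    using Suc.prems unfolding uniformly_continuous_on_def by fastforce
  obtain e where e: "e > 0" "\<And>x a. x 0 \<in> X \<Longrightarrow> (\<forall>n. a n \<in> T \<and> x (Suc n) = G (a n) (x n)) \<Longrightarrow>
    (\<forall>n<N. \<bar>a n - b\<bar> < e) \<Longrightarrow> \<bar>x N - (G b ^^ N) (x 0)\<bar> < h / 2"
    using Suc.IH[of "h / 2"] h(1) by (metis half_gt_zero)
  show ?case
  proof (intro exI[of _ "min e (h / 2)"] conjI allI impI)
    show "min e (h / 2) > 0" using e h by simp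
    fix x a assume x: "x 0 \<in> X" "\<forall>n. a n \<in> T \<and> x (Suc n) = G (a n) (x n)"
      and a: "\<forall>n<Suc N. \<bar>a n - b\<bar> < min e (h / 2)"
    have xN: "x n \<in> X" for n using x maps by (induction n) auto
    have yN: "(G b ^^ n) (x 0) \<in> X" for n using x b maps by (induction n) auto
    have "dist (a N, x N) (b, (G b ^^ N) (x 0)) \<le> \<bar>a N - b\<bar> + \<bar>x N - (G b ^^ N) (x 0)\<bar>"
      using sqrt_sum_squares_le_sum_abs by (simp add: dist_Pair_Pair dist_real_def)
    also have "\<dots> < h / 2 + h / 2" using e(2)[OF x] a by (intro add_strict_mono) auto
    finally have "dist (G (a N) (x N)) (G b ((G b ^^ N) (x 0))) < d"
      using h(2) x b xN yN by simp
    then show "\<bar>x (Suc N) - (G b ^^ Suc N) (x 0)\<bar> < d"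
      using x by (simp add: dist_real_def)
  qed
qed

section \<open>Averaged maps\<close>

definition averaged_map :: "(real \<Rightarrow> real) \<Rightarrow> real \<Rightarrow> real \<Rightarrow> real" where
  "averaged_map f a x = (1 - a) * f x + a * x"

lemma averaged_map_fixed_point: "f K = K \<Longrightarrow> averaged_map f a K = K"
  by (simp add: averaged_map_def algebra_simps)

text \<open>
  A closest crossing pair is a 2-cycle at whose ends the averaged map is nonincreasing. On the
  increasing branch of \<open>f\<close> the averaged map increases, so both ends lie beyond the peak \<open>c\<close>; by
  quasi-convexity of \<open>f'\<close> the averaged map then decreases on the whole interval between them, and there
  its Schwarzian derivative is negative. Singer's argument contradicts the attraction of \<open>K\<close>.
\<close>
lemma averaged_map_no_crossing_pair:
  fixes f f1 f2 f3 :: "real \<Rightarrow> real"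
  assumes a: "0 < a" "a < 1"
    and d1: "\<And>x. x > 0 \<Longrightarrow> (f has_real_derivative f1 x) (at x)"
    and d2: "\<And>x. x > 0 \<Longrightarrow> (f1 has_real_derivative f2 x) (at x)"
    and d3: "\<And>x. x > 0 \<Longrightarrow> (f2 has_real_derivative f3 x) (at x)"
    and c: "0 < c" "c < K"
    and inc: "\<And>x. 0 < x \<Longrightarrow> x \<le> c \<Longrightarrow> 0 \<le> f1 x" and dec: "\<And>x. c < x \<Longrightarrow> f1 x < 0"
    and S: "\<And>x. c < x \<Longrightarrow> 2 * f3 x * f1 x < 3 * (f2 x)\<^sup>2"
    and K: "f K = K" "-1 < (1 - a) * f1 K + a"
    and pair: "0 < r0" "r0 < K" "K < y0" "y0 \<le> averaged_map f a r0" "averaged_map f a y0 \<le> r0"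
  shows False
proof -
  have D1: "(averaged_map f a has_real_derivative (1 - a) * f1 x + a) (at x)" if "x > 0" for x
    unfolding averaged_map_def by (rule derivative_eq_intros d1[OF that] refl)+ simp
  have D2: "((\<lambda>x. (1 - a) * f1 x + a) has_real_derivative (1 - a) * f2 x) (at x)" if "x > 0" for x
    by (rule derivative_eq_intros d2[OF that] refl)+ simp
  have D3: "((\<lambda>x. (1 - a) * f2 x) has_real_derivative (1 - a) * f3 x) (at x)" if "x > 0" for x
    by (rule derivative_eq_intros d3[OF that] refl)+ simp
  have K0: "K > 0" using c by simp
  have gK: "averaged_map f a K = K" using K by (simp add: averaged_map_def algebra_simps)
  have "(1 - a) * f1 K + a < 1"
    using mult_pos_neg[of "1 - a" "f1 K"] dec[OF c(2)] a by simp
  with K have k: "\<bar>(1 - a) * f1 K + a\<bar> < 1" by auto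
  have cont: "continuous_on {r0..y0} (averaged_map f a)"
    using pair by (auto intro!: continuous_at_imp_continuous_on DERIV_isCont[OF D1])
  obtain r y where ry: "r0 \<le> r" "r < K" "K < y" "y \<le> y0" "averaged_map f a r = y" "averaged_map f a y = r"
    and right: "\<And>x. r < x \<Longrightarrow> x < K \<Longrightarrow> averaged_map f a x < averaged_map f a r"
    and left: "\<And>x. K < x \<Longrightarrow> x < y \<Longrightarrow> averaged_map f a y < averaged_map f a x"
    using crossing_pair_gives_two_cycle[OF gK D1[OF K0] k cont order_refl pair(2,3) order_refl pair(4,5)] by blast
  have r0: "0 < r" "0 < y" using ry pair by auto
  have r_neg: "(1 - a) * f1 r + a \<le> 0"
  proof (rule ccontr)
    assume "\<not> ?thesis"
    then obtain h where h: "h > 0" "\<And>t. 0 < t \<Longrightarrow> t < h \<Longrightarrow> averaged_map f a r < averaged_map f a (r + t)"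
      using DERIV_pos_inc_right[OF D1[OF r0(1)]] by auto
    define t where "t = min h (K - r) / 2"
    have "0 < t" "t < h" "r + t < K" using h(1) ry by (auto simp: t_def min_def field_simps)
    then show False using h(2)[of t] right[of "r + t"] by auto
  qed
  have y_neg: "(1 - a) * f1 y + a \<le> 0"
  proof (rule ccontr)
    assume "\<not> ?thesis"
    then obtain h where h: "h > 0" "\<And>t. 0 < t \<Longrightarrow> t < h \<Longrightarrow> averaged_map f a (y - t) < averaged_map f a y"
      using DERIV_pos_inc_left[OF D1[OF r0(2)]] by auto
    define t where "t = min h (y - K) / 2"
    have "0 < t" "t < h" "K < y - t" using h(1) ry by (auto simp: t_def min_def field_simps)
    then show False using h(2)[of t] left[of "y - t"] by auto
  qed
  have "c < r"
    using mult_nonneg_nonneg[OF _ inc, of "1 - a" r] r_neg r0 a by (cases "r \<le> c") auto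
  define b where "b = a / (1 - a)"
  have b: "b \<ge> 0" "(1 - a) * t + a = (1 - a) * (t + b)" for t
    using a by (auto simp: b_def field_simps)
  have slope: "f1 x < - b" if "r < x" "x < y" for x
  proof (rule deriv_below_between[OF that])
    show "f1 r \<le> - b" "f1 y \<le> - b"
      using r_neg y_neg a unfolding b(2) by (auto simp: mult_le_0_iff)
  qed (use \<open>c < r\<close> r0 in \<open>auto intro!: d2 d3 dec S\<close>)
  have "(1 - a) * f1 K + a \<le> -1"
  proof (rule neutral_or_repelling_in_two_cycle[OF ry(2,3) gK ry(5,6)])
    fix x assume x: "r < x" "x < y"
    show "(1 - a) * f1 x + a < 0"
      unfolding b(2) using slope[OF x] a by (auto intro!: mult_pos_neg)
    have "2 * f3 x * (f1 x + b) < 3 * (f2 x)\<^sup>2"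
      using schwarzian_negative_shift[OF b(1)] slope[OF x] S \<open>c < r\<close> x by auto
    then have "(1 - a)\<^sup>2 * (2 * f3 x * (f1 x + b)) < (1 - a)\<^sup>2 * (3 * (f2 x)\<^sup>2)"
      using a by (intro mult_strict_left_mono) auto
    then show "2 * ((1 - a) * f3 x) * ((1 - a) * f1 x + a) < 3 * ((1 - a) * f2 x)\<^sup>2"
      unfolding b(2) by (simp add: power2_eq_square algebra_simps)
  qed (use r0 in \<open>auto intro!: D1 D2 D3\<close>)
  with K show False by simp
qed

text \<open>
  The linear part of the averaged map at \<open>K\<close> has slope \<open>a - (1 - a) * L\<close>. The neighbourhood for a given
  linearisation error \<open>\<epsilon>\<close> does not depend on \<open>a\<close>.
\<close>
lemma averaged_map_local_contraction:
  assumes f: "(f has_real_derivative - L) (at K)" "f K = K" and \<epsilon>: "\<epsilon> > 0"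
  obtains \<eta> where "\<eta> > 0"
    "\<And>a x. 0 < a \<Longrightarrow> a < 1 \<Longrightarrow> \<bar>x - K\<bar> \<le> \<eta> \<Longrightarrow>
      \<bar>averaged_map f a x - K\<bar> \<le> (\<epsilon> + \<bar>a - (1 - a) * L\<bar>) * \<bar>x - K\<bar>"
proof -
  have "((\<lambda>x. f x + L * x) has_real_derivative 0) (at K)"
    by (rule derivative_eq_intros f(1) refl)+ simp
  then obtain \<eta> where \<eta>: "\<eta> > 0"
      "\<And>x. \<bar>x - K\<bar> < \<eta> \<Longrightarrow> \<bar>f x + L * x - (f K + L * K)\<bar> \<le> \<epsilon> * \<bar>x - K\<bar>"
    using deriv_local_bound[of "\<lambda>x. f x + L * x" 0 K \<epsilon>] \<epsilon> by auto
  show thesis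
  proof (rule that[of "\<eta> / 2"])
    fix a x :: real assume a: "0 < a" "a < 1" and x: "\<bar>x - K\<bar> \<le> \<eta> / 2"
    have "averaged_map f a x - K
        = (1 - a) * (f x + L * x - (f K + L * K)) + (a - (1 - a) * L) * (x - K)"
      by (simp add: averaged_map_def f(2) algebra_simps)
    then have "\<bar>averaged_map f a x - K\<bar>
        \<le> (1 - a) * \<bar>f x + L * x - (f K + L * K)\<bar> + \<bar>a - (1 - a) * L\<bar> * \<bar>x - K\<bar>"
      using a by (simp only:) (intro order_trans[OF abs_triangle_ineq], simp add: abs_mult)
    also have "\<dots> \<le> 1 * (\<epsilon> * \<bar>x - K\<bar>) + \<bar>a - (1 - a) * L\<bar> * \<bar>x - K\<bar>"
      using a x \<eta> by (intro add_mono mult_mono) auto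
    finally show "\<bar>averaged_map f a x - K\<bar> \<le> (\<epsilon> + \<bar>a - (1 - a) * L\<bar>) * \<bar>x - K\<bar>"
      by (simp add: algebra_simps)
  qed (use \<eta> in auto)
qed

lemma has_real_derivative_half_deriv:
  assumes "g differentiable_on {0..}" "x > 0"
  shows "(g has_real_derivative half_deriv g x) (at x)"
proof -
  have "g differentiable (at x within {0..})"
    using assms by (auto simp: differentiable_on_def)
  moreover have "at x within {0..} = at x"
    using assms(2) by (intro at_within_interior) (simp add: interior_real_atLeast)
  ultimately obtain d where d: "(g has_real_derivative d) (at x)"
    by (auto simp: real_differentiable_def)
  then show ?thesis
    using half_deriv_eq[OF has_field_derivative_at_within[OF d]] assms(2) by simp
qed

text \<open>
  Extracts from the assumptions on \<open>f\<close> what the attraction argument consumes: two-sided derivatives, the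
  sign of \<open>f'\<close> on either side of the peak, and the Schwarzian inequality beyond the peak without its
  denominators.
\<close>
lemma assumption_C_obtains:
  assumes C: "assumption_C f K"
  obtains f2 f3 c where
    "\<And>x. x > 0 \<Longrightarrow> (f has_real_derivative half_deriv f x) (at x)"
    "\<And>x. x > 0 \<Longrightarrow> (half_deriv f has_real_derivative f2 x) (at x)"
    "\<And>x. x > 0 \<Longrightarrow> (f2 has_real_derivative f3 x) (at x)"
    "0 < c" "c < K" "\<And>x. 0 \<le> x \<Longrightarrow> f x \<le> f c"
    "\<And>x. 0 < x \<Longrightarrow> x \<le> c \<Longrightarrow> 0 \<le> half_deriv f x"
    "\<And>x. c < x \<Longrightarrow> half_deriv f x < 0"
    "\<And>x. c < x \<Longrightarrow> 2 * f3 x * half_deriv f x < 3 * (f2 x)\<^sup>2"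
proof -
  define f2 where "f2 = half_deriv (half_deriv f)"
  define f3 where "f3 = half_deriv f2"
  have pow: "(half_deriv ^^ 2) f = f2" "(half_deriv ^^ 3) f = f3"
    by (simp_all add: f2_def f3_def eval_nat_numeral)
  have three: "three_times_differentiable f" using C by (simp add: assumption_C_def)
  have "f differentiable_on {0..}" "half_deriv f differentiable_on {0..}" "f2 differentiable_on {0..}"
    using three[unfolded three_times_differentiable_def, rule_format, of 0]
      three[unfolded three_times_differentiable_def, rule_format, of 1]
      three[unfolded three_times_differentiable_def, rule_format, of 2] by (simp_all add: pow)
  note D = this[THEN has_real_derivative_half_deriv, folded f2_def, folded f3_def]
  obtain c where c: "0 < c" "c < K" "unimodal_with_peak f c"
      "\<And>x. x > 0 \<Longrightarrow> half_deriv f x = 0 \<longleftrightarrow> x = c" "\<And>x. x \<ge> 0 \<Longrightarrow> f x \<le> f c"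
      "\<And>x. x > 0 \<Longrightarrow> x \<noteq> c \<Longrightarrow> schwarzian f x < 0"
    using C unfolding assumption_C_def by auto
  have inc: "0 \<le> half_deriv f x" if x: "0 < x" "x < c" for x
  proof (rule ccontr)
    assume "\<not> 0 \<le> half_deriv f x"
    then obtain h where h: "h > 0" "\<And>t. 0 < t \<Longrightarrow> t < h \<Longrightarrow> f (x + t) < f x"
      using DERIV_neg_dec_right[OF D(1)[OF x(1)]] by auto
    define t where "t = min h (c - x) / 2"
    have t: "0 < t" "t < h" "x + t < c" using h(1) that by (auto simp: t_def min_def field_simps)
    then have "f x < f (x + t)"
      using c(3) that by (auto simp: unimodal_with_peak_def strict_mono_on_def)
    with h(2)[of t] t show False by simp
  qed
  have dec: "half_deriv f x < 0" if x: "c < x" for x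
  proof (rule ccontr)
    assume "\<not> half_deriv f x < 0"
    then have "0 < half_deriv f x" using c(1) c(4)[of x] that by auto
    then obtain h where h: "h > 0" "\<And>t. 0 < t \<Longrightarrow> t < h \<Longrightarrow> f x < f (x + t)"
      using DERIV_pos_inc_right[OF D(1), of x] c(1) x by auto
    have "f (x + h / 2) < f x"
      using c(3) that h(1) by (auto simp: unimodal_with_peak_def monotone_on_def)
    with h(2)[of "h / 2"] h(1) show False by simp
  qed
  have S: "2 * f3 x * half_deriv f x < 3 * (f2 x)\<^sup>2" if "c < x" for x
  proof -
    define d where "d = half_deriv f x"
    have d: "d < 0" using dec[OF that] by (simp add: d_def)
    have "f3 x / d - 3 / 2 * (f2 x / d)\<^sup>2 < 0"
      using c(6)[of x] c(1) that by (simp add: schwarzian_def pow d_def)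
    then have "2 * d\<^sup>2 * (f3 x / d - 3 / 2 * (f2 x / d)\<^sup>2) < 0"
      using d by (intro mult_pos_neg) auto
    also have "2 * d\<^sup>2 * (f3 x / d - 3 / 2 * (f2 x / d)\<^sup>2) = 2 * f3 x * d - 3 * (f2 x)\<^sup>2"
      using d by (simp add: field_simps power2_eq_square)
    finally show ?thesis by (simp add: d_def)
  qed
  have inc': "0 \<le> half_deriv f x" if "0 < x" "x \<le> c" for x
    using inc[of x] c(4)[of x] that by (cases "x = c") auto
  show thesis
    by (rule that[OF D c(1,2,5) inc' dec S])
qed

lemma assumption_C_deriv_at_fixed_point:
  assumes "assumption_C f K"
  shows "(f has_real_derivative half_deriv f K) (at K)" "half_deriv f K < 0"
proof -
  have K: "K > 0" using assms by (simp add: assumption_C_def)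
  show "(f has_real_derivative half_deriv f K) (at K)"
  proof (rule assumption_C_obtains[OF assms])
    assume "\<And>x. x > 0 \<Longrightarrow> (f has_real_derivative half_deriv f x) (at x)"
    then show "(f has_real_derivative half_deriv f K) (at K)" using K by simp
  qed
  show "half_deriv f K < 0"
  proof (rule assumption_C_obtains[OF assms])
    fix c assume "c < K" "\<And>x. c < x \<Longrightarrow> half_deriv f x < 0"
    then show "half_deriv f K < 0" by simp
  qed
qed

lemma assumption_C_fixed_point: "assumption_C f K \<Longrightarrow> f K = K"
  by (auto simp: assumption_C_def)

text \<open>
  Above, no average of \<open>x\<close> and \<open>f x\<close> exceeds the larger of \<open>x\<close> and the peak value. Below, the averaged map
  moves no point of \<open>{0..K}\<close> down, and a point above \<open>K\<close> keeps at least the fraction \<open>s\<close> of its value. The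
  interval serves all control strengths at once.
\<close>
lemma averaged_map_trapping_interval:
  assumes C: "assumption_C f K" and s: "0 < s" "t < 1" and x0: "x0 > 0"
  obtains u V where "0 < u" "u < K" "K < V" "x0 \<in> {u..V}"
    "\<And>a x. a \<in> {s..t} \<Longrightarrow> x \<in> {u..V} \<Longrightarrow> averaged_map f a x \<in> {u..V}"
proof -
  obtain c where c: "0 < c" "c < K" "\<And>x. 0 \<le> x \<Longrightarrow> f x \<le> f c"
    using assumption_C_obtains[OF C] by metis
  have K: "K > 0" "f K = K" using c assumption_C_fixed_point[OF C] by auto
  have f: "\<And>x. 0 \<le> x \<Longrightarrow> 0 \<le> f x" "\<And>x. 0 < x \<Longrightarrow> x \<le> K \<Longrightarrow> x \<le> f x"
    using C K(2) by (auto simp: assumption_C_def less_le)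
  define u where "u = min x0 (min s (1/2) * K)"
  define V where "V = max x0 (f c) + 1"
  have "min s (1/2) * K \<le> s * K" "min s (1/2) * K \<le> (1/2) * K" "0 < min s (1/2) * K"
    using K s by (auto intro!: mult_right_mono)
  then have u: "0 < u" "u < K" "u \<le> s * K" "u \<le> x0"
    using K x0 unfolding u_def by linarith+
  have V: "K < V" "f c \<le> V" "x0 \<le> V" using c(3)[of K] K by (auto simp: V_def)
  show thesis
  proof (rule that[OF u(1,2) V(1)])
    show "x0 \<in> {u..V}" using u V by simp
    fix a x assume ax: "a \<in> {s..t}" "x \<in> {u..V}"
    then have a: "0 < a" "a < 1" and x: "0 < x" using s u by auto
    have "averaged_map f a x \<le> (1 - a) * V + a * V"
      unfolding averaged_map_def using a x ax c(3)[of x] V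
      by (intro add_mono mult_left_mono) auto
    moreover have "u \<le> averaged_map f a x"
    proof (cases "x \<le> K")
      case True
      then have "(1 - a) * x + a * x \<le> averaged_map f a x"
        unfolding averaged_map_def using a x f(2)[of x] by (intro add_mono mult_left_mono) auto
      then show ?thesis using ax by (simp add: algebra_simps)
    next
      case False
      then have "s * K \<le> a * x" using ax s K by (intro mult_mono) auto
      moreover have "0 \<le> (1 - a) * f x" using a x f(1)[of x] by simp
      ultimately show ?thesis using u by (simp add: averaged_map_def)
    qed
    ultimately show "averaged_map f a x \<in> {u..V}" by (simp add: algebra_simps)
  qed
qed

text \<open>
  With the constant control \<open>b\<close> all points of the trapping interval reach the vicinity of \<open>K\<close> within a
  common number of steps; over these finitely many steps a control close to \<open>b\<close> does almost the same.
\<close>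
lemma averaged_map_uniform_entry:
  assumes C: "assumption_C f K" and s: "0 < s" "s \<le> b" "b < 1"
    and stable: "-1 < (1 - b) * half_deriv f K + b"
    and u: "0 < u" "u < K" "K < V"
    and maps: "\<And>a x. a \<in> {s..b} \<Longrightarrow> x \<in> {u..V} \<Longrightarrow> averaged_map f a x \<in> {u..V}"
    and d: "d > 0"
  shows "\<exists>N. \<exists>e>0. \<forall>x a. x 0 \<in> {u..V} \<longrightarrow>
    (\<forall>n. a n \<in> {s..b} \<and> x (Suc n) = averaged_map f (a n) (x n)) \<longrightarrow>
    (\<forall>n<N. \<bar>a n - b\<bar> < e) \<longrightarrow> \<bar>x N - K\<bar> < d"
proof -
  have fK: "f K = K" by (rule assumption_C_fixed_point[OF C])
  have contf: "continuous_on {0..} f" using C by (simp add: assumption_C_def)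
  have cont2: "continuous_on ({s..b} \<times> {u..V}) (\<lambda>(a, x). averaged_map f a x)"
    unfolding averaged_map_def case_prod_beta
    by (intro continuous_intros continuous_on_compose2[OF contf]) (use u in auto)
  have cont: "continuous_on {u..V} (averaged_map f b)"
    unfolding averaged_map_def
    by (intro continuous_intros continuous_on_subset[OF contf]) (use u in auto)
  have conv: "averaged_map f b x - x = (1 - b) * (f x - x)" for x
    by (simp add: averaged_map_def algebra_simps)
  have below: "x < averaged_map f b x" if "u \<le> x" "x < K" for x
  proof -
    have "0 < (1 - b) * (f x - x)" using C that u s by (simp add: assumption_C_def)
    then show ?thesis using conv[of x] by simp
  qed
  have above: "averaged_map f b x < x" if "K < x" for x
  proof -
    have "(1 - b) * (f x - x) < 0" using C that s by (intro mult_pos_neg) (auto simp: assumption_C_def)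
    then show ?thesis using conv[of x] by simp
  qed
  have no_pair: False
    if "u \<le> r" "r < K" "K < y" "y \<le> averaged_map f b r" "averaged_map f b y \<le> r" for r y
  proof (rule assumption_C_obtains[OF C])
    fix f2 f3 :: "real \<Rightarrow> real" and c
    assume *: "\<And>x. x > 0 \<Longrightarrow> (f has_real_derivative half_deriv f x) (at x)"
      "\<And>x. x > 0 \<Longrightarrow> (half_deriv f has_real_derivative f2 x) (at x)"
      "\<And>x. x > 0 \<Longrightarrow> (f2 has_real_derivative f3 x) (at x)"
      "0 < c" "c < K"
      "\<And>x. 0 < x \<Longrightarrow> x \<le> c \<Longrightarrow> 0 \<le> half_deriv f x"
      "\<And>x. c < x \<Longrightarrow> half_deriv f x < 0"
      "\<And>x. c < x \<Longrightarrow> 2 * f3 x * half_deriv f x < 3 * (f2 x)\<^sup>2"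
    show False
      using averaged_map_no_crossing_pair[of b f "half_deriv f" f2 f3 c K r y] * s fK stable that u
      by auto
  qed
  have mapsb: "averaged_map f b ` {u..V} \<subseteq> {u..V}" using maps[of b] s by auto
  have "\<exists>N. \<forall>x\<in>{u..V}. \<bar>(averaged_map f b ^^ N) x - K\<bar> < d / 2"
    by (rule uniform_attraction_if_no_crossing_pair[OF u(2,3) averaged_map_fixed_point[of f K b, OF fK] cont mapsb])
      (use below above no_pair d in auto)
  then obtain N where N: "\<And>x. x \<in> {u..V} \<Longrightarrow> \<bar>(averaged_map f b ^^ N) x - K\<bar> < d / 2"
    by blast
  obtain e where e: "e > 0" "\<forall>x a. x 0 \<in> {u..V} \<longrightarrow>
      (\<forall>n. a n \<in> {s..b} \<and> x (Suc n) = averaged_map f (a n) (x n)) \<longrightarrow>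
      (\<forall>n<N. \<bar>a n - b\<bar> < e) \<longrightarrow> \<bar>x N - (averaged_map f b ^^ N) (x 0)\<bar> < d / 2"
    using perturbed_orbit_close[where G = "averaged_map f" and T = "{s..b}" and X = "{u..V}"
        and b = b and d = "d / 2" and N = N] cont2 maps s d by auto
  have "\<bar>x N - K\<bar> < d" if x: "x 0 \<in> {u..V}"
    "\<forall>n. a n \<in> {s..b} \<and> x (Suc n) = averaged_map f (a n) (x n)" "\<forall>n<N. \<bar>a n - b\<bar> < e" for x a
  proof -
    have "\<bar>x N - (averaged_map f b ^^ N) (x 0)\<bar> < d / 2" using e(2) x by blast
    with N[OF x(1)] show ?thesis by linarith
  qed
  with e(1) show ?thesis by blast
qed

section \<open>Independent noise\<close>

lemma (in prob_space) indep_vars_Suc: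
  assumes "indep_vars (\<lambda>_. N) X {1..}"
  shows "indep_vars (\<lambda>_. N) (\<lambda>n::nat. X (Suc n)) UNIV"
proof -
  \<comment> \<open>Grouping the family into the singletons \<open>{Suc j}\<close> relabels it.\<close>
  have "indep_vars (\<lambda>j. PiM {Suc j} (\<lambda>_. N)) (\<lambda>j \<omega>. restrict (\<lambda>i. X i \<omega>) {Suc j}) UNIV"
    by (rule indep_vars_restrict[OF assms]) (auto simp: disjoint_family_on_def)
  from indep_vars_compose2[OF this, of "\<lambda>j z. z (Suc j)" "\<lambda>_. N"] show ?thesis
    by simp
qed

text \<open>
  By Hoeffding's lemma the moment is at most \<open>exp (p * \<mu> + p\<^sup>2 * B\<^sup>2 / 2)\<close> with \<open>\<mu> < 0\<close> the mean, and
  the linear term wins for small \<open>p\<close>; the choice \<open>p = - \<mu> / B\<^sup>2\<close> minimises the exponent.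
\<close>
lemma (in prob_space) exp_moment_less_one:
  fixes h :: "'a \<Rightarrow> real"
  assumes [measurable]: "h \<in> borel_measurable M" and B: "B > 0" "\<And>\<omega>. \<bar>h \<omega>\<bar> \<le> B"
    and neg: "expectation h < 0"
  obtains p where "p > 0" "(\<integral>\<^sup>+\<omega>. ennreal (exp (p * h \<omega>)) \<partial>M) < 1"
proof -
  interpret interval_bounded_random_variable M h "-B" B
    by unfold_locales (use B in \<open>auto intro!: AE_I2 simp: abs_le_iff minus_le_iff\<close>)
  define \<mu> where "\<mu> = expectation h"
  define p where "p = - \<mu> / B\<^sup>2"
  have p: "p > 0" using neg B by (simp add: p_def \<mu>_def divide_neg_pos)
  have "(\<integral>\<^sup>+\<omega>. ennreal (exp (p * h \<omega>)) \<partial>M)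
      = (\<integral>\<^sup>+\<omega>. ennreal (exp (p * \<mu>)) * ennreal (exp (p * (h \<omega> - \<mu>))) \<partial>M)"
    by (simp flip: ennreal_mult exp_add add: algebra_simps)
  also have "\<dots> = ennreal (exp (p * \<mu>)) * (\<integral>\<^sup>+\<omega>. ennreal (exp (p * (h \<omega> - \<mu>))) \<partial>M)"
    by (intro nn_integral_cmult) measurable
  also have "\<dots> \<le> ennreal (exp (p * \<mu>)) * ennreal (exp (p\<^sup>2 * (B - (- B))\<^sup>2 / 8))"
    unfolding \<mu>_def by (intro mult_left_mono Hoeffdings_lemma_nn_integral p) auto
  also have "\<dots> = ennreal (exp (- \<mu>\<^sup>2 / (2 * B\<^sup>2)))"
    using B(1) by (simp flip: ennreal_mult exp_add) (simp add: p_def power2_eq_square field_simps)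
  also have "\<dots> < 1"
    using neg B(1) by (simp add: \<mu>_def ennreal_less_one_iff)
  finally show thesis using that p by blast
qed

text \<open>
  Each \<open>G n\<close> is decided by the variables from time \<open>n\<close> on, so the event that \<open>G n\<close> happens infinitely
  often is a tail event. Its probability is at least \<open>\<kappa>\<close>, hence 1 by Kolmogorov's zero-one law. The
  \<open>G n\<close> may depend on each other, which is why the second Borel-Cantelli lemma would not do.
\<close>
lemma (in prob_space) AE_eventually_occurs_of_tail_observable:
  fixes X :: "nat \<Rightarrow> 'a \<Rightarrow> 'b" and G :: "nat \<Rightarrow> 'a set"
  assumes X: "indep_vars (\<lambda>_. N) X UNIV"
    and G: "\<And>n. G n \<in> sets (sigma (space M) (\<Union>i\<in>{n..}. {X i -` A \<inter> space M |A. A \<in> sets N}))"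
    and \<kappa>: "\<kappa> > 0" "\<And>n. \<kappa> \<le> prob (G n)"
  shows "AE \<omega> in M. \<exists>n. \<omega> \<in> G n"
proof -
  define F where "F i = sigma_sets (space M) {X i -` A \<inter> space M |A. A \<in> sets N}" for i
  have rv [measurable]: "random_variable N (X i)" for i
    using X by (auto simp: indep_vars_def)
  have F: "indep_sets F UNIV" using X by (auto simp: indep_vars_def F_def[abs_def])
  have sa: "sigma_algebra (space M) (F i)" for i
    unfolding F_def by (rule sigma_algebra_sigma_sets) auto
  have Fsub: "F i \<subseteq> events" for i using F by (auto simp: indep_sets_def)
  have G': "G m \<in> sigma_sets (space M) (\<Union>(F ` {n..}))" if "n \<le> m" for m n
  proof -
    have "G m \<in> sigma_sets (space M) (\<Union>i\<in>{m..}. {X i -` A \<inter> space M |A. A \<in> sets N})"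
      using G[of m] by (subst (asm) sets_measure_of) auto
    also have "\<dots> \<subseteq> sigma_sets (space M) (\<Union>(F ` {n..}))"
      using that by (intro sigma_sets_mono) (fastforce simp: F_def)
    finally show ?thesis .
  qed
  define T where "T = (\<Inter>n. \<Union>m\<in>{n..}. G m)"
  have tail: "T \<in> tail_events F"
    unfolding tail_events_def
  proof
    fix j
    interpret S: sigma_algebra "space M" "sigma_sets (space M) (\<Union>(F ` {j..}))"
      by (rule sigma_algebra_sigma_sets)
        (use Fsub sets.sets_into_space in blast)
    have "T = (\<Inter>n\<in>{j..}. \<Union>m\<in>{n..}. G m)"
      unfolding T_def by (intro decseq_SucI INT_decseq_offset UN_mono) auto
    also have "\<dots> \<in> sigma_sets (space M) (\<Union>(F ` {j..}))"
      by (safe intro!: S.countable_INT S.countable_UN) (auto intro!: G')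
    finally show "T \<in> sigma_sets (space M) (\<Union>(F ` {j..}))" .
  qed
  have Gev [measurable]: "G n \<in> events" for n
  proof -
    have "sigma_sets (space M) (\<Union>(F ` {n..})) \<subseteq> events"
      using Fsub by (intro sets.sigma_sets_subset) auto
    then show ?thesis using G'[of n n] by auto
  qed
  have Tev [measurable]: "T \<in> events" unfolding T_def by measurable
  have "(\<lambda>n. prob (\<Union>m\<in>{n..}. G m)) \<longlonglongrightarrow> prob T"
    unfolding T_def
    by (rule finite_Lim_measure_decseq) (auto simp: decseq_def intro: order_trans)
  moreover have "\<kappa> \<le> prob (\<Union>m\<in>{n..}. G m)" for n
    using \<kappa>(2)[of n] finite_measure_mono[of "G n" "\<Union>m\<in>{n..}. G m"] by fastforce
  ultimately have "\<kappa> \<le> prob T" by (intro LIMSEQ_le_const) auto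
  then have "prob T = 1"
    using kolmogorov_0_1_law[OF sa F tail] \<kappa>(1) by auto
  then have "AE \<omega> in M. \<omega> \<in> T" by (simp add: prob_eq_1)
  then show ?thesis by (rule AE_mp) (auto simp: T_def intro!: AE_I2)
qed

lemma (in prob_space) iid_nn_integral_prod:
  fixes X :: "nat \<Rightarrow> 'a \<Rightarrow> 'b" and \<phi> :: "nat \<Rightarrow> 'b \<Rightarrow> ennreal"
  assumes X: "indep_vars (\<lambda>_. N) X UNIV" and id: "\<And>n. distr M N (X n) = distr M N (X 0)"
    and [measurable]: "\<And>i. \<phi> i \<in> borel_measurable N"
  shows "(\<integral>\<^sup>+\<omega>. (\<Prod>i<k. \<phi> i (X (n + i) \<omega>)) \<partial>M) = (\<Prod>i<k. \<integral>\<^sup>+\<omega>. \<phi> i (X 0 \<omega>) \<partial>M)"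
proof -
  have rv [measurable]: "random_variable N (X i)" for i
    using X by (auto simp: indep_vars_def)
  have ind: "indep_vars (\<lambda>_. borel) (\<lambda>j \<omega>. \<phi> (j - n) (X j \<omega>)) {n..<n + k}"
    by (rule indep_vars_compose2[OF indep_vars_subset[OF X]]) auto
  have same: "(\<integral>\<^sup>+\<omega>. \<phi> i (X m \<omega>) \<partial>M) = (\<integral>\<^sup>+\<omega>. \<phi> i (X 0 \<omega>) \<partial>M)" for i m
    using arg_cong[OF id[of m], of "\<lambda>D. nn_integral D (\<phi> i)"] by (simp add: nn_integral_distr)
  have re: "(\<Prod>i<k. F (n + i)) = (\<Prod>j\<in>{n..<n + k}. F j)" for F :: "nat \<Rightarrow> ennreal"
    by (rule prod.reindex_bij_witness[of _ "\<lambda>j. j - n" "\<lambda>i. n + i"]) auto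
  have "(\<integral>\<^sup>+\<omega>. (\<Prod>i<k. \<phi> i (X (n + i) \<omega>)) \<partial>M)
      = (\<integral>\<^sup>+\<omega>. (\<Prod>j\<in>{n..<n + k}. \<phi> (j - n) (X j \<omega>)) \<partial>M)"
    by (simp flip: re)
  also have "\<dots> = (\<Prod>j\<in>{n..<n + k}. \<integral>\<^sup>+\<omega>. \<phi> (j - n) (X j \<omega>) \<partial>M)"
    by (rule indep_vars_nn_integral[OF _ ind]) auto
  also have "\<dots> = (\<Prod>i<k. \<integral>\<^sup>+\<omega>. \<phi> i (X (n + i) \<omega>) \<partial>M)"
    by (simp flip: re)
  also have "\<dots> = (\<Prod>i<k. \<integral>\<^sup>+\<omega>. \<phi> i (X 0 \<omega>) \<partial>M)" by (intro prod.cong refl same)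
   finally show ?thesis .
qed

text \<open>
  Fix an exponential moment \<open>q = E (exp (p * h)) < 1\<close>. On the event that the block lies in \<open>S\<close>, the walk
  started after it exceeds \<open>R\<close> at time \<open>m\<close> with probability at most \<open>\<pi> ^ N * exp (- p * R) * q ^ m\<close>, by
  Markov's inequality. Summing over \<open>m\<close>, a level \<open>R\<close> that depends on \<open>p\<close> and \<open>q\<close> alone leaves at least
  half of the probability \<open>\<pi> ^ N\<close> of the block, uniformly in the starting time \<open>n\<close>. That \<open>R\<close> is chosen
  before \<open>S\<close> and \<open>N\<close> is essential: the length of the block and the tolerance for the noise will be
  chosen from \<open>R\<close>.
\<close>
lemma (in prob_space) AE_block_then_bounded_walk:
  fixes X :: "nat \<Rightarrow> 'a \<Rightarrow> real" and h :: "real \<Rightarrow> real"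
  assumes X: "indep_vars (\<lambda>_. borel) X UNIV"
    and id: "\<And>n. distr M borel (X n) = distr M borel (X 0)"
    and h [measurable]: "h \<in> borel_measurable borel" and B: "B > 0" "\<And>t. \<bar>h t\<bar> \<le> B"
    and neg: "expectation (\<lambda>\<omega>. h (X 0 \<omega>)) < 0"
  obtains R where
    "\<And>S N. S \<in> sets borel \<Longrightarrow> 0 < prob {\<omega> \<in> space M. X 0 \<omega> \<in> S} \<Longrightarrow>
       AE \<omega> in M. \<exists>n. (\<forall>i<N. X (n + i) \<omega> \<in> S) \<and> (\<forall>m. (\<Sum>i<m. h (X (n + N + i) \<omega>)) \<le> R)"
proof -
  have rv [measurable]: "random_variable borel (X i)" for i
    using X by (auto simp: indep_vars_def)
  obtain p where p: "p > 0" and q1: "(\<integral>\<^sup>+\<omega>. ennreal (exp (p * h (X 0 \<omega>))) \<partial>M) < 1"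
    by (rule exp_moment_less_one[OF _ B(1) B(2) neg]) measurable
  define q where "q = enn2real (\<integral>\<^sup>+\<omega>. ennreal (exp (p * h (X 0 \<omega>))) \<partial>M)"
  have q_eq: "(\<integral>\<^sup>+\<omega>. ennreal (exp (p * h (X 0 \<omega>))) \<partial>M) = ennreal q"
    unfolding q_def using q1 by (subst ennreal_enn2real) (auto intro: order_less_trans)
  have q: "0 \<le> q" "q < 1"
    using q1 unfolding q_eq by (auto simp: q_def ennreal_less_one_iff)
  define R where "R = - ln ((1 - q) / 2) / p"
  have "exp (- p * R) \<le> (1 - q) / 2"
    using p q by (simp add: R_def)
  then have eR: "exp (- p * R) / (1 - q) \<le> 1 / 2" using q by (simp add: field_simps)
  show thesis
  proof (rule that)
    fix S :: "real set" and N :: nat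
    assume S [measurable]: "S \<in> sets borel" and pos: "0 < prob {\<omega> \<in> space M. X 0 \<omega> \<in> S}"
    define \<pi> where "\<pi> = prob {\<omega> \<in> space M. X 0 \<omega> \<in> S}"
    define W where "W n m \<omega> = (\<Sum>i<m. h (X (n + N + i) \<omega>))" for n m \<omega>
    define A where "A n = {\<omega> \<in> space M. \<forall>i<N. X (n + i) \<omega> \<in> S}" for n
    define E where "E n m = {\<omega> \<in> space M. (\<forall>i<N. X (n + i) \<omega> \<in> S) \<and> R < W n m \<omega>}" for n m
    define G where "G n = {\<omega> \<in> space M. (\<forall>i<N. X (n + i) \<omega> \<in> S) \<and> (\<forall>m. W n m \<omega> \<le> R)}" for n
    \<comment> \<open>The first \<open>N\<close> factors select the block, the later ones build up the exponential of the walk.\<close>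
    define \<phi> :: "nat \<Rightarrow> real \<Rightarrow> ennreal"
      where "\<phi> i t = (if i < N then indicator S t else ennreal (exp (p * h t)))" for i t
    have \<phi> [measurable]: "\<phi> i \<in> borel_measurable borel" for i
      unfolding \<phi>_def by measurable
    have W [measurable]: "W n m \<in> borel_measurable M" for n m unfolding W_def by measurable
    have [measurable]: "A n \<in> events" "E n m \<in> events" "G n \<in> events" for n m
      unfolding A_def E_def G_def by measurable
    have ind: "(\<integral>\<^sup>+\<omega>. indicator S (X 0 \<omega>) \<partial>M) = ennreal \<pi>"
    proof -
      have "(\<integral>\<^sup>+\<omega>. indicator S (X 0 \<omega>) \<partial>M) = (\<integral>\<^sup>+\<omega>. indicator {\<omega> \<in> space M. X 0 \<omega> \<in> S} \<omega> \<partial>M)"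
        by (intro nn_integral_cong) (auto simp: indicator_def)
      also have "\<dots> = ennreal \<pi>" by (simp add: \<pi>_def emeasure_eq_measure)
      finally show ?thesis .
    qed
    have split: "(\<Prod>i<N + m. F i) = (\<Prod>i<N. F i) * (\<Prod>i<m. F (N + i))" for m and F :: "nat \<Rightarrow> ennreal"
      by (induction m) (auto simp: mult.assoc)
    have block: "(\<Prod>i<N. \<phi> i (X (n + i) \<omega>)) = indicator (A n) \<omega>" if "\<omega> \<in> space M" for n \<omega>
      using that by (auto simp: A_def \<phi>_def indicator_def prod_zero_iff)
    have walk: "(\<Prod>i<m. \<phi> (N + i) (X (n + (N + i)) \<omega>)) = ennreal (exp (p * W n m \<omega>))" for n m \<omega>
      by (simp add: \<phi>_def prod_ennreal exp_sum sum_distrib_left W_def add.assoc)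
    have moment: "(\<integral>\<^sup>+\<omega>. indicator (A n) \<omega> * ennreal (exp (p * W n m \<omega>)) \<partial>M) = ennreal (\<pi> ^ N * q ^ m)" for n m
    proof -
      have "(\<integral>\<^sup>+\<omega>. indicator (A n) \<omega> * ennreal (exp (p * W n m \<omega>)) \<partial>M)
          = (\<integral>\<^sup>+\<omega>. (\<Prod>i<N + m. \<phi> i (X (n + i) \<omega>)) \<partial>M)"
        by (intro nn_integral_cong) (simp add: split block walk)
      also have "\<dots> = (\<Prod>i<N + m. \<integral>\<^sup>+\<omega>. \<phi> i (X 0 \<omega>) \<partial>M)"
        by (rule iid_nn_integral_prod[OF X id]) measurable
      also have "\<dots> = ennreal (\<pi> ^ N * q ^ m)"
        unfolding split using q pos
        by (simp add: \<phi>_def ind q_eq ennreal_power ennreal_mult \<pi>_def)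
      finally show ?thesis .
    qed
    have pA: "prob (A n) = \<pi> ^ N" for n
    proof -
      have "emeasure M (A n) = ennreal (\<pi> ^ N)" using moment[of n 0] by (simp add: W_def)
      then show ?thesis using pos by (simp add: emeasure_eq_measure \<pi>_def)
    qed
    have pE: "prob (E n m) \<le> \<pi> ^ N * exp (- p * R) * q ^ m" for n m
    proof -
      have "emeasure M (E n m) = (\<integral>\<^sup>+\<omega>. indicator (E n m) \<omega> \<partial>M)" by simp
      also have "\<dots> \<le> (\<integral>\<^sup>+\<omega>. ennreal (exp (- p * R)) * (indicator (A n) \<omega> * ennreal (exp (p * W n m \<omega>))) \<partial>M)"
      proof (intro nn_integral_mono)
        fix \<omega> assume "\<omega> \<in> space M"
        show "indicator (E n m) \<omega> \<le> ennreal (exp (- p * R)) * (indicator (A n) \<omega> * ennreal (exp (p * W n m \<omega>)))"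
        proof (cases "\<omega> \<in> E n m")
          case True
          then have "\<omega> \<in> A n" "R < W n m \<omega>" by (auto simp: A_def E_def)
          then have "1 \<le> exp (- p * R) * exp (p * W n m \<omega>)"
            using p by (simp flip: exp_add)
          then have "ennreal 1 \<le> ennreal (exp (- p * R) * exp (p * W n m \<omega>))"
            by (rule ennreal_leI)
          then show ?thesis using True \<open>\<omega> \<in> A n\<close> by (simp add: ennreal_mult)
        qed simp
      qed
      also have "\<dots> = ennreal (exp (- p * R)) * ennreal (\<pi> ^ N * q ^ m)"
        by (subst nn_integral_cmult) (auto simp: moment)
      also have "\<dots> = ennreal (\<pi> ^ N * exp (- p * R) * q ^ m)"
        by (simp flip: ennreal_mult' add: ac_simps)
      finally show ?thesis
        using q pos by (simp add: emeasure_eq_measure \<pi>_def)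
    qed
    have geo: "(\<lambda>m. \<pi> ^ N * exp (- p * R) * q ^ m) sums (\<pi> ^ N * exp (- p * R) * (1 / (1 - q)))"
      using q by (intro sums_mult geometric_sums) auto
    have pU: "prob (\<Union>m. E n m) \<le> \<pi> ^ N / 2" for n
    proof -
      have sm: "summable (\<lambda>m. prob (E n m))"
        by (rule summable_comparison_test'[OF sums_summable[OF geo], of 0]) (use pE in auto)
      have "prob (\<Union>m. E n m) \<le> (\<Sum>m. prob (E n m))"
        by (rule finite_measure_subadditive_countably) (auto intro: sm)
      also have "\<dots> \<le> (\<Sum>m. \<pi> ^ N * exp (- p * R) * q ^ m)"
        by (intro suminf_le pE sm sums_summable[OF geo])
      also have "\<dots> = \<pi> ^ N * (exp (- p * R) / (1 - q))" using sums_unique[OF geo] by simp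
      also have "\<dots> \<le> \<pi> ^ N * (1 / 2)" using eR pos by (intro mult_left_mono) (auto simp: \<pi>_def)
      finally show ?thesis by simp
    qed
    have pG: "\<pi> ^ N / 2 \<le> prob (G n)" for n
    proof -
      have "A n \<subseteq> G n \<union> (\<Union>m. E n m)" by (auto simp: A_def G_def E_def not_le)
      then have "prob (A n) \<le> prob (G n \<union> (\<Union>m. E n m))" by (intro finite_measure_mono) auto
      also have "\<dots> \<le> prob (G n) + prob (\<Union>m. E n m)" by (intro measure_Un_le) auto
      finally show ?thesis using pA[of n] pU[of n] by simp
    qed
    have "AE \<omega> in M. \<exists>n. \<omega> \<in> G n"
    proof (rule AE_eventually_occurs_of_tail_observable[OF X _ _ pG])
      show "\<pi> ^ N / 2 > 0" using pos by (simp add: \<pi>_def)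
      fix n
      define \<F> where "\<F> = sigma (space M) (\<Union>i\<in>{n..}. {X i -` A \<inter> space M |A. A \<in> sets borel})"
      have sp: "space \<F> = space M" by (simp add: \<F>_def space_measure_of_conv)
      have [measurable]: "X (n + i) \<in> borel_measurable \<F>" for i
      proof (rule measurableI)
        fix A :: "real set" assume "A \<in> sets borel"
        then show "X (n + i) -` A \<inter> space \<F> \<in> sets \<F>"
          unfolding sp unfolding \<F>_def by (subst sets_measure_of) (auto intro!: sigma_sets.Basic bexI[of _ "n + i"] exI[of _ A])
      qed simp
      have [measurable]: "X (n + N + i) \<in> borel_measurable \<F>" for i
        unfolding add.assoc by measurable
      have "G n = {\<omega> \<in> space \<F>. (\<forall>i<N. X (n + i) \<omega> \<in> S) \<and> (\<forall>m. W n m \<omega> \<le> R)}"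
        by (simp add: G_def sp)
      also have "\<dots> \<in> sets \<F>" unfolding W_def by measurable
      finally show "G n \<in> sets (sigma (space M) (\<Union>i\<in>{n..}. {X i -` A \<inter> space M |A. A \<in> sets borel}))"
        by (simp add: \<F>_def)
    qed
    then show "AE \<omega> in M. \<exists>n. (\<forall>i<N. X (n + i) \<omega> \<in> S) \<and> (\<forall>m. (\<Sum>i<m. h (X (n + N + i) \<omega>)) \<le> R)"
      by (rule AE_mp) (auto simp: G_def W_def intro!: AE_I2)
  qed
qed

section \<open>Almost sure convergence\<close>

text \<open>
  The bound \<open>R\<close> on the partial sums keeps the orbit in the region where \<open>step\<close> applies if it starts
  \<open>exp R\<close> times closer, and the spare factor \<open>\<theta>\<close> then drives it to \<open>K\<close>.
\<close>
lemma contraction_with_bounded_cumulative_exponents: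
  fixes x H :: "nat \<Rightarrow> real"
  assumes \<theta>: "0 \<le> \<theta>" "\<theta> < 1"
    and start: "\<bar>x 0 - K\<bar> \<le> \<eta> * exp (- R)" and \<eta>: "\<eta> > 0"
    and step: "\<And>n. \<bar>x n - K\<bar> \<le> \<eta> \<Longrightarrow> \<bar>x (Suc n) - K\<bar> \<le> \<theta> * exp (H n) * \<bar>x n - K\<bar>"
    and R: "\<And>n. (\<Sum>i<n. H i) \<le> R"
  shows "x \<longlonglongrightarrow> K"
proof -
  have small: "\<theta> ^ n * exp (\<Sum>i<n. H i) * (\<eta> * exp (- R)) \<le> \<theta> ^ n * \<eta>" for n
  proof -
    have "exp (\<Sum>i<n. H i) * exp (- R) \<le> 1" using R[of n] by (simp flip: exp_add)
    then have "\<theta> ^ n * \<eta> * (exp (\<Sum>i<n. H i) * exp (- R)) \<le> \<theta> ^ n * \<eta> * 1"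
      using \<theta> \<eta> by (intro mult_left_mono) auto
    then show ?thesis by (simp add: ac_simps)
  qed
  have bound: "\<bar>x n - K\<bar> \<le> \<theta> ^ n * exp (\<Sum>i<n. H i) * (\<eta> * exp (- R))" for n
  proof (induction n)
    case (Suc n)
    have "\<theta> ^ n * \<eta> \<le> \<eta>" using \<theta> \<eta> by (simp add: power_le_one)
    then have "\<bar>x (Suc n) - K\<bar> \<le> \<theta> * exp (H n) * \<bar>x n - K\<bar>"
      using Suc small[of n] by (intro step) linarith
    also have "\<dots> \<le> \<theta> * exp (H n) * (\<theta> ^ n * exp (\<Sum>i<n. H i) * (\<eta> * exp (- R)))"
      using Suc \<theta> by (intro mult_left_mono) auto
    finally show ?case by (simp add: exp_add ac_simps)
  qed (use start in simp)
  have "(\<lambda>n. \<theta> ^ n * \<eta>) \<longlonglongrightarrow> 0"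
    using \<theta> by (intro tendsto_mult_left_zero LIMSEQ_power_zero) auto
  then have "(\<lambda>n. x n - K) \<longlonglongrightarrow> 0"
    by (rule Lim_null_comparison[rotated])
      (use order_trans[OF bound small] in \<open>auto intro!: always_eventually\<close>)
  then show ?thesis by (rule LIM_zero_cancel)
qed

text \<open>
  The common core of both alternatives: \<open>Y a\<close> is any continuous positive bound for the modulus of the
  slope of the averaged map at \<open>K\<close>, and it has to be contractive on average, \<open>E (ln Y) < 0\<close>. Almost
  surely there is a time at which a long block of noise values near 1 carries the solution very close
  to \<open>K\<close>, and after which the products of the values of \<open>Y\<close> never grow enough to let it escape.
\<close>
lemma averaged_solution_converges_AE:
  fixes M :: "'a measure" and \<xi> :: "nat \<Rightarrow> 'a \<Rightarrow> real" and Y :: "real \<Rightarrow> real"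
  assumes noise: "noise_assumption M \<xi>" and C: "assumption_C f K"
    and l: "0 < l" "l < \<alpha>" "\<alpha> + l < 1"
    and stable: "-1 < (1 - (\<alpha> + l)) * half_deriv f K + (\<alpha> + l)"
    and contY: "continuous_on {\<alpha> - l..\<alpha> + l} Y"
    and posY: "\<And>a. a \<in> {\<alpha> - l..\<alpha> + l} \<Longrightarrow> 0 < Y a"
    and domY: "\<And>a. a \<in> {\<alpha> - l..\<alpha> + l} \<Longrightarrow> \<bar>(1 - a) * half_deriv f K + a\<bar> \<le> Y a"
    and neg: "(\<integral>\<omega>. ln (Y (\<alpha> + l * \<xi> 1 \<omega>)) \<partial>M) < 0"
    and x0: "x0 > 0" and sol: "controlled_solution M f \<alpha> l \<xi> x0 x"
  shows "AE \<omega> in M. (\<lambda>n. x n \<omega>) \<longlonglongrightarrow> K"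
proof -
  interpret prob_space M using noise by (simp add: noise_assumption_def)
  define I where "I = {\<alpha> - l..\<alpha> + l}"
  define X where "X n = \<xi> (Suc n)" for n
  have X: "indep_vars (\<lambda>_. borel) X UNIV"
    using indep_vars_Suc[of borel \<xi>] noise by (simp add: noise_assumption_def X_def[abs_def])
  have id: "distr M borel (X n) = distr M borel (X 0)" for n
    using noise by (auto simp: noise_assumption_def X_def)
  have rv [measurable]: "random_variable borel (X n)" for n
    using X by (auto simp: indep_vars_def)
  have X1: "\<bar>X n \<omega>\<bar> \<le> 1" if "\<omega> \<in> space M" for n \<omega>
    using noise that by (auto simp: noise_assumption_def X_def)
  have inI: "\<alpha> + l * X n \<omega> \<in> I" if "\<omega> \<in> space M" for n \<omega>
  proof -
    have "\<bar>l * X n \<omega>\<bar> \<le> l * 1" unfolding abs_mult using X1[OF that, of n] l by (intro mult_mono) auto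
    then show ?thesis by (auto simp: I_def abs_le_iff)
  qed
  have I01: "0 < a" "a < 1" if "a \<in> I" for a using that l by (auto simp: I_def)

  \<comment> \<open>Clamping the noise to \<open>{-1..1}\<close> turns the exponent into a bounded function on the line.\<close>
  define clamp :: "real \<Rightarrow> real" where "clamp t = max (-1) (min 1 t)" for t
  have clampI: "\<alpha> + l * clamp t \<in> I" for t
  proof -
    have "\<bar>l * clamp t\<bar> \<le> l * 1" unfolding abs_mult using l by (intro mult_mono) (auto simp: clamp_def)
    then show ?thesis by (auto simp: I_def abs_le_iff)
  qed
  have contln: "continuous_on I (\<lambda>a. ln (Y a))"
    using contY by (intro continuous_on_ln) (auto simp: I_def dest: posY)
  define k where "k t = ln (Y (\<alpha> + l * clamp t))" for t
  have "continuous_on UNIV k"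
    unfolding k_def
    by (rule continuous_on_compose2[OF contln])
      (use clampI in \<open>auto simp: clamp_def[abs_def] intro!: continuous_intros\<close>)
  then have k [measurable]: "k \<in> borel_measurable borel"
    by (rule borel_measurable_continuous_onI)
  have "bounded ((\<lambda>a. ln (Y a)) ` I)"
    using contln by (intro compact_imp_bounded compact_continuous_image) (auto simp: I_def)
  then obtain B where B: "B > 0" "\<And>a. a \<in> I \<Longrightarrow> \<bar>ln (Y a)\<bar> \<le> B"
    unfolding bounded_pos by auto
  have kB: "\<bar>k t\<bar> \<le> B" for t unfolding k_def by (rule B(2)[OF clampI])
  have kX: "k (X n \<omega>) = ln (Y (\<alpha> + l * X n \<omega>))" if "\<omega> \<in> space M" for n \<omega>
    using X1[OF that, of n] by (simp add: k_def clamp_def abs_le_iff)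
  define \<kappa> where "\<kappa> = - expectation (\<lambda>\<omega>. k (X 0 \<omega>))"
  have "expectation (\<lambda>\<omega>. k (X 0 \<omega>)) = (\<integral>\<omega>. ln (Y (\<alpha> + l * \<xi> 1 \<omega>)) \<partial>M)"
    by (intro Bochner_Integration.integral_cong) (simp_all add: kX, simp add: X_def)
  then have \<kappa>0: "\<kappa> > 0" using neg by (simp add: \<kappa>_def)
  have intk: "integrable M (\<lambda>\<omega>. k (X 0 \<omega>))"
    by (rule integrable_const_bound[where B = B]) (auto simp: kB)
  define h where "h t = k t + \<kappa> / 2" for t
  have h: "h \<in> borel_measurable borel" unfolding h_def by measurable
  have hB: "\<bar>h t\<bar> \<le> B + \<kappa>" for t unfolding h_def using kB[of t] \<kappa>0 by linarith
  have "expectation (\<lambda>\<omega>. h (X 0 \<omega>)) = - \<kappa> / 2"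
    unfolding h_def using intk by (simp add: prob_space \<kappa>_def)
  then obtain R where R:
    "\<And>S N. S \<in> sets borel \<Longrightarrow> 0 < prob {\<omega> \<in> space M. X 0 \<omega> \<in> S} \<Longrightarrow>
       AE \<omega> in M. \<exists>n. (\<forall>i<N. X (n + i) \<omega> \<in> S) \<and> (\<forall>m. (\<Sum>i<m. h (X (n + N + i) \<omega>)) \<le> R)"
    using AE_block_then_bounded_walk[OF X id h _ hB] B(1) \<kappa>0 by auto

  \<comment> \<open>Of the slack \<open>\<kappa>\<close>, half is left to the walk as its negative drift; the other half is
     shared between the linearisation error and the contraction factor \<open>\<theta>\<close>.\<close>
  define \<theta> where "\<theta> = exp (- \<kappa> / 4)"
  define \<epsilon> where "\<epsilon> = (exp (\<kappa> / 4) - 1) * exp (- B)"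
  have \<epsilon>: "\<epsilon> > 0" using \<kappa>0 by (simp add: \<epsilon>_def)
  have fK: "f K = K" by (rule assumption_C_fixed_point[OF C])
  have fK': "(f has_real_derivative - (- half_deriv f K)) (at K)"
    using assumption_C_deriv_at_fixed_point(1)[OF C] by simp
  obtain \<eta> where \<eta>: "\<eta> > 0" "\<And>a x. 0 < a \<Longrightarrow> a < 1 \<Longrightarrow> \<bar>x - K\<bar> \<le> \<eta> \<Longrightarrow>
      \<bar>averaged_map f a x - K\<bar> \<le> (\<epsilon> + \<bar>a - (1 - a) * (- half_deriv f K)\<bar>) * \<bar>x - K\<bar>"
    using averaged_map_local_contraction[of f "- half_deriv f K" K \<epsilon>, OF fK' fK \<epsilon>] by blast
  have local: "\<bar>averaged_map f (\<alpha> + l * X n \<omega>) z - K\<bar> \<le> \<theta> * exp (h (X n \<omega>)) * \<bar>z - K\<bar>"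
    if \<omega>: "\<omega> \<in> space M" and z: "\<bar>z - K\<bar> \<le> \<eta>" for n \<omega> z
  proof -
    define a where "a = \<alpha> + l * X n \<omega>"
    have a: "a \<in> I" unfolding a_def by (rule inI[OF \<omega>])
    have Ya: "0 < Y a" using posY a by (auto simp: I_def)
    have "- B \<le> ln (Y a)" using B(2)[OF a] by simp
    then have "exp (- B) \<le> Y a" using Ya by (simp add: ln_ge_iff)
    then have "\<epsilon> \<le> (exp (\<kappa> / 4) - 1) * Y a"
      unfolding \<epsilon>_def using \<kappa>0 by (intro mult_left_mono) auto
    moreover have "\<bar>a - (1 - a) * (- half_deriv f K)\<bar> \<le> Y a"
      using domY[of a] a by (simp add: I_def algebra_simps)
    ultimately have "\<epsilon> + \<bar>a - (1 - a) * (- half_deriv f K)\<bar> \<le> exp (\<kappa> / 4) * Y a"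
      by (simp add: algebra_simps)
    also have "\<dots> = \<theta> * exp (h (X n \<omega>))"
      using Ya by (simp add: h_def kX[OF \<omega>] \<theta>_def exp_add flip: a_def)
        (simp flip: exp_add mult.assoc)
    finally have "(\<epsilon> + \<bar>a - (1 - a) * (- half_deriv f K)\<bar>) * \<bar>z - K\<bar>
        \<le> \<theta> * exp (h (X n \<omega>)) * \<bar>z - K\<bar>"
      by (intro mult_right_mono) auto
    with \<eta>(2)[OF I01[OF a] z] show ?thesis by (simp add: a_def)
  qed

  have s: "0 < \<alpha> - l" "\<alpha> - l \<le> \<alpha> + l" using l by auto
  obtain u V where uV: "0 < u" "u < K" "K < V" "x0 \<in> {u..V}"
    "\<And>a x. a \<in> I \<Longrightarrow> x \<in> {u..V} \<Longrightarrow> averaged_map f a x \<in> {u..V}"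
    unfolding I_def using averaged_map_trapping_interval[OF C s(1) l(3) x0] by metis
  have "\<eta> * exp (- R) > 0" using \<eta>(1) by simp
  from averaged_map_uniform_entry[OF C s l(3) stable uV(1-3) uV(5)[unfolded I_def] this, folded I_def]
  obtain N e where e: "e > 0" "\<forall>x a. x 0 \<in> {u..V} \<longrightarrow>
      (\<forall>n. a n \<in> I \<and> x (Suc n) = averaged_map f (a n) (x n)) \<longrightarrow>
      (\<forall>n<N. \<bar>a n - (\<alpha> + l)\<bar> < e) \<longrightarrow> \<bar>x N - K\<bar> < \<eta> * exp (- R)" by blast
  have pos: "0 < prob {\<omega> \<in> space M. X 0 \<omega> \<in> {1 - e / l<..1}}"
    using noise e(1) l(1) by (auto simp: noise_assumption_def X_def)
  have "AE \<omega> in M. \<exists>n. (\<forall>i<N. X (n + i) \<omega> \<in> {1 - e / l<..1}) \<and>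
      (\<forall>m. (\<Sum>i<m. h (X (n + N + i) \<omega>)) \<le> R)"
    by (rule R[OF _ pos]) simp
  then show ?thesis
  proof (rule AE_mp, intro AE_I2 impI)
    fix \<omega> assume \<omega>: "\<omega> \<in> space M"
      and "\<exists>n. (\<forall>i<N. X (n + i) \<omega> \<in> {1 - e / l<..1}) \<and>
        (\<forall>m. (\<Sum>i<m. h (X (n + N + i) \<omega>)) \<le> R)"
    then obtain n where n: "\<And>i. i < N \<Longrightarrow> X (n + i) \<omega> \<in> {1 - e / l<..1}"
      "\<And>m. (\<Sum>i<m. h (X (n + N + i) \<omega>)) \<le> R" by auto
    have rec: "x (Suc m) \<omega> = averaged_map f (\<alpha> + l * X m \<omega>) (x m \<omega>)" for m
      using sol \<omega> by (simp add: controlled_solution_def averaged_map_def X_def diff_diff_eq)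
    have trap: "x m \<omega> \<in> {u..V}" for m
    proof (induction m)
      case 0
      then show ?case using sol \<omega> uV(4) by (simp add: controlled_solution_def)
    next
      case (Suc m)
      then show ?case unfolding rec by (intro uV(5) inI[OF \<omega>])
    qed
    have near: "\<bar>x (n + N) \<omega> - K\<bar> < \<eta> * exp (- R)"
    proof -
      have close: "\<bar>\<alpha> + l * X (n + i) \<omega> - (\<alpha> + l)\<bar> < e" if "i < N" for i
      proof -
        have "\<bar>X (n + i) \<omega> - 1\<bar> < e / l" using n(1)[OF that] by auto
        then have "l * \<bar>X (n + i) \<omega> - 1\<bar> < e" using l(1) by (simp add: field_simps)
        moreover have "\<alpha> + l * X (n + i) \<omega> - (\<alpha> + l) = l * (X (n + i) \<omega> - 1)"
          by (simp add: algebra_simps)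
        ultimately show ?thesis using l(1) by (simp add: abs_mult)
      qed
      have step: "x (n + Suc i) \<omega> = averaged_map f (\<alpha> + l * X (n + i) \<omega>) (x (n + i) \<omega>)" for i
        using rec[of "n + i"] by simp
      show ?thesis
      proof (rule e(2)[THEN spec[of _ "\<lambda>i. x (n + i) \<omega>"],
            THEN spec[of _ "\<lambda>i. \<alpha> + l * X (n + i) \<omega>"], THEN mp, THEN mp, THEN mp])
        show "x (n + 0) \<omega> \<in> {u..V}" by (rule trap)
        show "\<forall>i. \<alpha> + l * X (n + i) \<omega> \<in> I \<and>
            x (n + Suc i) \<omega> = averaged_map f (\<alpha> + l * X (n + i) \<omega>) (x (n + i) \<omega>)"
          by (intro allI conjI inI[OF \<omega>] step)
        show "\<forall>i<N. \<bar>\<alpha> + l * X (n + i) \<omega> - (\<alpha> + l)\<bar> < e"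
          by (intro allI impI close)
      qed
    qed
    have "(\<lambda>i. x (n + N + i) \<omega>) \<longlonglongrightarrow> K"
    proof (rule contraction_with_bounded_cumulative_exponents[of \<theta>])
      show "0 \<le> \<theta>" "\<theta> < 1" using \<kappa>0 by (auto simp: \<theta>_def)
      show "\<bar>x (n + N + 0) \<omega> - K\<bar> \<le> \<eta> * exp (- R)" using near by simp
      show "\<eta> > 0" by (fact \<eta>(1))
      show "(\<Sum>i<m. h (X (n + N + i) \<omega>)) \<le> R" for m by (fact n(2))
      show "\<bar>x (n + N + Suc m) \<omega> - K\<bar> \<le> \<theta> * exp (h (X (n + N + m) \<omega>)) * \<bar>x (n + N + m) \<omega> - K\<bar>"
        if "\<bar>x (n + N + m) \<omega> - K\<bar> \<le> \<eta>" for m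
        using local[OF \<omega> that] rec[of "n + N + m"] by simp
    qed
    then have "(\<lambda>i. x (i + (n + N)) \<omega>) \<longlonglongrightarrow> K" by (simp add: add.commute)
    then show "(\<lambda>n. x n \<omega>) \<longlonglongrightarrow> K" by (rule LIMSEQ_offset)
  qed
qed

theorem theorem4:
  fixes M :: "'a measure" and \<xi> :: "nat \<Rightarrow> 'a \<Rightarrow> real" and f :: "real \<Rightarrow> real"
    and K L0 \<alpha>0 \<alpha> l lam1 x0 :: real and x :: "nat \<Rightarrow> 'a \<Rightarrow> real"
  assumes noise: "noise_assumption M \<xi>"
    and C: "assumption_C f K"
    and L0: "L0 = - half_deriv f K"
    and \<alpha>0: "\<alpha>0 = (- half_deriv f K - 1) / (- half_deriv f K + 1)"
    and \<alpha>: "\<alpha> \<in> {0<..<\<alpha>0}"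
    and l: "l \<in> {\<alpha>0 - \<alpha><..<min \<alpha> (1 - \<alpha>)}"
    and lam1: "lam1 > 0"
    and cond:
      "(\<alpha> + l < L0 / (L0 + 1) \<and>
        prob_space.expectation M (\<lambda>\<omega>. ln ((1 - \<alpha> - l * \<xi> 1 \<omega>) * L0 - \<alpha> - l * \<xi> 1 \<omega>)) = - lam1) \<or>
       prob_space.expectation M (\<lambda>\<omega>. max (ln ((1 - \<alpha> - l * \<xi> 1 \<omega>) * L0)) (ln (\<alpha> + l * \<xi> 1 \<omega>))) = - lam1"
    and x0: "x0 > 0"
    and sol: "controlled_solution M f \<alpha> l \<xi> x0 x"
  shows "AE \<omega> in M. (\<lambda>n. x n \<omega>) \<longlonglongrightarrow> K"
proof -
  have l': "0 < l" "l < \<alpha>" "\<alpha> + l < 1" using \<alpha> l by auto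
  have L0pos: "L0 > 0" using assumption_C_deriv_at_fixed_point(2)[OF C] by (simp add: L0)
  have "\<alpha>0 = (L0 - 1) / (L0 + 1)" by (simp add: \<alpha>0 L0)
  moreover have "\<alpha>0 < \<alpha> + l" using l by simp
  ultimately have "L0 - 1 < (\<alpha> + l) * (L0 + 1)" using L0pos by (simp add: divide_less_eq)
  then have stable: "-1 < (1 - (\<alpha> + l)) * half_deriv f K + (\<alpha> + l)"
    unfolding L0 by (simp add: algebra_simps)
  note converges = averaged_solution_converges_AE[OF noise C l' stable _ _ _ _ x0 sol]
  have range01: "0 < a" "a < 1" if "a \<in> {\<alpha> - l..\<alpha> + l}" for a using that l' by auto
  from cond show ?thesis
  proof (elim disjE conjE)
    assume small: "\<alpha> + l < L0 / (L0 + 1)"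
      and E: "prob_space.expectation M (\<lambda>\<omega>. ln ((1 - \<alpha> - l * \<xi> 1 \<omega>) * L0 - \<alpha> - l * \<xi> 1 \<omega>)) = - lam1"
    have pos: "0 < (1 - a) * L0 - a" if "a \<in> {\<alpha> - l..\<alpha> + l}" for a
    proof -
      have "a < L0 / (L0 + 1)" using that small by simp
      then show ?thesis using L0pos by (simp add: less_divide_eq algebra_simps)
    qed
    show ?thesis
    proof (rule converges[of "\<lambda>a. (1 - a) * L0 - a"])
      show "\<bar>(1 - a) * half_deriv f K + a\<bar> \<le> (1 - a) * L0 - a" if "a \<in> {\<alpha> - l..\<alpha> + l}" for a
        using pos[OF that] by (simp add: L0)
      show "(\<integral>\<omega>. ln ((1 - (\<alpha> + l * \<xi> 1 \<omega>)) * L0 - (\<alpha> + l * \<xi> 1 \<omega>)) \<partial>M) < 0"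
        using E lam1 by (simp add: diff_diff_eq)
    qed (use pos in \<open>auto intro!: continuous_intros\<close>)
  next
    assume E: "prob_space.expectation M (\<lambda>\<omega>. max (ln ((1 - \<alpha> - l * \<xi> 1 \<omega>) * L0)) (ln (\<alpha> + l * \<xi> 1 \<omega>))) = - lam1"
    have ln_max: "ln (max ((1 - a) * L0) a) = max (ln ((1 - a) * L0)) (ln a)"
      if "a \<in> {\<alpha> - l..\<alpha> + l}" for a
      using range01[OF that] L0pos by (auto simp: max_def)
    show ?thesis
    proof (rule converges[of "\<lambda>a. max ((1 - a) * L0) a"])
      show "\<bar>(1 - a) * half_deriv f K + a\<bar> \<le> max ((1 - a) * L0) a" if "a \<in> {\<alpha> - l..\<alpha> + l}" for a
      proof -
        have "0 < (1 - a) * L0" using range01[OF that] L0pos by simp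
        then show ?thesis using range01[OF that] by (simp add: L0 max_def)
      qed
      have "(\<integral>\<omega>. ln (max ((1 - (\<alpha> + l * \<xi> 1 \<omega>)) * L0) (\<alpha> + l * \<xi> 1 \<omega>)) \<partial>M)
          = (\<integral>\<omega>. max (ln ((1 - \<alpha> - l * \<xi> 1 \<omega>) * L0)) (ln (\<alpha> + l * \<xi> 1 \<omega>)) \<partial>M)"
      proof (intro Bochner_Integration.integral_cong refl)
        fix \<omega> assume "\<omega> \<in> space M"
        then have "\<bar>l * \<xi> 1 \<omega>\<bar> \<le> l * 1"
          unfolding abs_mult using noise l' by (intro mult_mono) (auto simp: noise_assumption_def)
        then have "\<alpha> + l * \<xi> 1 \<omega> \<in> {\<alpha> - l..\<alpha> + l}" by (auto simp: abs_le_iff)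
        from ln_max[OF this]
        show "ln (max ((1 - (\<alpha> + l * \<xi> 1 \<omega>)) * L0) (\<alpha> + l * \<xi> 1 \<omega>))
          = max (ln ((1 - \<alpha> - l * \<xi> 1 \<omega>) * L0)) (ln (\<alpha> + l * \<xi> 1 \<omega>))"
          by (simp add: diff_diff_eq)
      qed
      then show "(\<integral>\<omega>. ln (max ((1 - (\<alpha> + l * \<xi> 1 \<omega>)) * L0) (\<alpha> + l * \<xi> 1 \<omega>)) \<partial>M) < 0"
        using E lam1 by simp
    qed (use range01 in \<open>auto intro!: continuous_intros simp: less_max_iff_disj\<close>)
  qed
qed

end
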